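(* Let $1<p<\infty$ and let $T\in\mathcal L(\ell_p)$. Then $$W_e(T)=\bigcap\bigl\{\overline{W(T+K)}:\ K\in\mathcal K(\ell_p)\bigr\}.$$
   Context: $\ell_p=\ell_p(\mathbb N)$ is the complex sequence space, $\mathcal L(\ell_p)$ its algebra of bounded linear operators, $\mathcal K(\ell_p)$ the ideal of compact operators; the bar denotes closure in $\mathbb C$. With $1/p+1/q=1$, the dual $(\ell_p)^*$ is identified with $\ell_q$ via $\langle x,y\rangle=\sum_j x_j\overline{y_j}$. For $x=(x_j)\in\ell_p$ put $J(x)=(x_j|x_j|^{p-2})_j\in\ell_q$ (with $0$ in the coordinates where $x_j=0$). The numerical range of $S\in\mathcal L(\ell_p)$ is $W(S)=\{\langle Sx,J(x)\rangle:\ x\in\ell_p,\ \|x\|_p=1\}$. The essential numerical range $W_e(T)$ is the set of all $\lambda\in\mathbb C$ for which there is a net (equivalently, a sequence) of unit vectors $x_\alpha\in\ell_p$ with $x_\alpha\to0$ weakly and $\langle Tx_\alpha,J(x_\alpha)\rangle\to\lambda$. *)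

theory Defs
  imports "HOL-Analysis.Analysis"
begin

definition lp :: "real \<Rightarrow> (nat \<Rightarrow> complex) set" where
  "lp p = {x. summable (\<lambda>j. norm (x j) powr p)}"

definition lp_norm :: "real \<Rightarrow> (nat \<Rightarrow> complex) \<Rightarrow> real" where
  "lp_norm p x = (\<Sum>j. norm (x j) powr p) powr (1 / p)"

definition lp_dist :: "real \<Rightarrow> (nat \<Rightarrow> complex) \<Rightarrow> (nat \<Rightarrow> complex) \<Rightarrow> real" where
  "lp_dist p x y = lp_norm p (\<lambda>j. x j - y j)"

text \<open>
  The norm topology of \<open>\<ell>\<^sub>p\<close>. That \<^term>\<open>lp_dist p\<close> is a metric on \<^term>\<open>lp p\<close>
  for \<open>p \<ge> 1\<close> is lemma \<open>Metric_space_lp\<close> below.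
\<close>

definition lp_topology :: "real \<Rightarrow> (nat \<Rightarrow> complex) topology" where
  "lp_topology p = Metric_space.mtopology (lp p) (lp_dist p)"

text \<open>
  Elements of \<open>\<L>(\<ell>\<^sub>p)\<close> are represented by functions on all sequences; only their values
  on \<^term>\<open>lp p\<close> are constrained, and no notion below depends on the other values.
\<close>

definition lp_operators :: "real \<Rightarrow> ((nat \<Rightarrow> complex) \<Rightarrow> nat \<Rightarrow> complex) set" where
  "lp_operators p = {T.
     (\<forall>x\<in>lp p. T x \<in> lp p) \<and>
     (\<forall>x\<in>lp p. \<forall>y\<in>lp p. T (\<lambda>j. x j + y j) = (\<lambda>j. T x j + T y j)) \<and>
     (\<forall>c. \<forall>x\<in>lp p. T (\<lambda>j. c * x j) = (\<lambda>j. c * T x j)) \<and>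
     (\<exists>C. \<forall>x\<in>lp p. lp_norm p (T x) \<le> C * lp_norm p x)}"

definition lp_compact_operators :: "real \<Rightarrow> ((nat \<Rightarrow> complex) \<Rightarrow> nat \<Rightarrow> complex) set" where
  "lp_compact_operators p = {K \<in> lp_operators p.
     compactin (lp_topology p)
       (lp_topology p closure_of (K ` {x \<in> lp p. lp_norm p x \<le> 1}))}"

definition pairing :: "(nat \<Rightarrow> complex) \<Rightarrow> (nat \<Rightarrow> complex) \<Rightarrow> complex" where
  "pairing x y = (\<Sum>j. x j * cnj (y j))"

text \<open>The value at coordinates with \<open>x j = 0\<close> is \<open>0\<close>, also for \<open>p < 2\<close>.\<close>

definition lp_J :: "real \<Rightarrow> (nat \<Rightarrow> complex) \<Rightarrow> nat \<Rightarrow> complex" where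
  "lp_J p x = (\<lambda>j. x j * of_real (norm (x j) powr (p - 2)))"

text \<open>Weak convergence to 0, with \<open>(\<ell>\<^sub>p)\<^sup>*\<close> identified with \<open>\<ell>\<^sub>q\<close> via the pairing.\<close>

definition lp_weakly_null :: "real \<Rightarrow> (nat \<Rightarrow> nat \<Rightarrow> complex) \<Rightarrow> bool" where
  "lp_weakly_null p x \<longleftrightarrow>
     (\<forall>q. 1 / p + 1 / q = 1 \<longrightarrow> (\<forall>y\<in>lp q. (\<lambda>n. pairing (x n) y) \<longlonglongrightarrow> 0))"

definition num_range :: "real \<Rightarrow> ((nat \<Rightarrow> complex) \<Rightarrow> nat \<Rightarrow> complex) \<Rightarrow> complex set" where
  "num_range p S = {pairing (S x) (lp_J p x) |x. x \<in> lp p \<and> lp_norm p x = 1}"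

definition ess_num_range :: "real \<Rightarrow> ((nat \<Rightarrow> complex) \<Rightarrow> nat \<Rightarrow> complex) \<Rightarrow> complex set" where
  "ess_num_range p T = {l. \<exists>x :: nat \<Rightarrow> nat \<Rightarrow> complex.
     (\<forall>n. x n \<in> lp p \<and> lp_norm p (x n) = 1) \<and> lp_weakly_null p x \<and>
     (\<lambda>n. pairing (T (x n)) (lp_J p (x n))) \<longlonglongrightarrow> l}"


lemma powr_convex_nonneg:
  fixes p a b s t :: real
  assumes "p \<ge> 1" "a \<ge> 0" "b \<ge> 0" "a + b = 1" "s \<ge> 0" "t \<ge> 0"
  shows "(a * s + b * t) powr p \<le> a * s powr p + b * t powr p"
proof -
  have le: "(c * u) powr p \<le> c * u powr p" if "0 \<le> c" "c \<le> 1" "0 \<le> u" for c u :: real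
  proof -
    have "c powr p \<le> c"
      using that assms(1) powr_mono'[of 1 p c] by simp
    then show ?thesis
      using that by (simp add: powr_mult mult_right_mono)
  qed
  show ?thesis
  proof (cases "s = 0 \<or> t = 0")
    case True
    then show ?thesis
      using le[of a s] le[of b t] assms by auto
  next
    case False
    have a: "a = 1 - b" "b \<le> 1"
      using assms by auto
    show ?thesis
      using convex_onD[OF powr_convex[OF assms(1)], of b s t] False assms(3,5,6) a(2)
      unfolding a(1) by simp
  qed
qed

lemma lp_add_aux:
  fixes A B :: real
  assumes p: "p \<ge> 1" and x: "x \<in> lp p" and y: "y \<in> lp p"
    and A: "A > 0" "lp_norm p x \<le> A" and B: "B > 0" "lp_norm p y \<le> B"
  shows "(\<lambda>j. x j + y j) \<in> lp p" "lp_norm p (\<lambda>j. x j + y j) \<le> A + B"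
proof -
  let ?a = "A / (A + B)" and ?b = "B / (A + B)"
  let ?g = "\<lambda>j. (A + B) powr p *
    (?a * (norm (x j) powr p / A powr p) + ?b * (norm (y j) powr p / B powr p))"
  have ab: "?a \<ge> 0" "?b \<ge> 0" "?a + ?b = 1"
    using A B by (auto simp: add_divide_distrib[symmetric])
  have sx: "summable (\<lambda>j. norm (x j) powr p)" and sy: "summable (\<lambda>j. norm (y j) powr p)"
    using x y by (auto simp: lp_def)
  have le: "norm (x j + y j) powr p \<le> ?g j" for j
  proof -
    have "norm (x j + y j) \<le> norm (x j) + norm (y j)"
      by (rule norm_triangle_ineq)
    also have "\<dots> = (A + B) * (?a * (norm (x j) / A) + ?b * (norm (y j) / B))"
      using A B by (simp add: distrib_left)
    finally have "norm (x j + y j) powr p \<le>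
        ((A + B) * (?a * (norm (x j) / A) + ?b * (norm (y j) / B))) powr p"
      using p by (intro powr_mono2) auto
    also have "\<dots> = (A + B) powr p * (?a * (norm (x j) / A) + ?b * (norm (y j) / B)) powr p"
      using A B by (subst powr_mult) auto
    also have "\<dots> \<le> (A + B) powr p *
        (?a * (norm (x j) / A) powr p + ?b * (norm (y j) / B) powr p)"
      using ab A B p by (intro mult_left_mono powr_convex_nonneg) auto
    finally show ?thesis
      using A B by (simp add: powr_divide)
  qed
  have sg: "summable ?g"
    by (intro summable_mult summable_add summable_divide sx sy)
  have s: "summable (\<lambda>j. norm (x j + y j) powr p)"
    by (rule summable_comparison_test'[OF sg, of 0]) (use le in auto)
  then show "(\<lambda>j. x j + y j) \<in> lp p"
    by (simp add: lp_def)
  have root: "(\<Sum>j. norm (z j) powr p) \<le> C powr p" if "lp_norm p z \<le> C" "z \<in> lp p" for z C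
  proof -
    have "0 \<le> (\<Sum>j. norm (z j) powr p)"
      using that by (intro suminf_nonneg) (auto simp: lp_def)
    then have "(\<Sum>j. norm (z j) powr p) = lp_norm p z powr p"
      using p by (simp add: lp_norm_def powr_powr)
    also have "\<dots> \<le> C powr p"
      using that p by (intro powr_mono2) (auto simp: lp_norm_def)
    finally show ?thesis .
  qed
  have "(\<Sum>j. norm (x j + y j) powr p) \<le> suminf ?g"
    by (intro suminf_le le s sg)
  also have "suminf ?g = (A + B) powr p *
      (?a * ((\<Sum>j. norm (x j) powr p) / A powr p) + ?b * ((\<Sum>j. norm (y j) powr p) / B powr p))"
    by (rule sums_unique[symmetric], intro sums_mult sums_add sums_divide summable_sums sx sy)
  also have "\<dots> \<le> (A + B) powr p * (?a * 1 + ?b * 1)"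
    using root[OF A(2) x] root[OF B(2) y] A B ab
    by (intro mult_left_mono add_mono) auto
  finally have "(\<Sum>j. norm (x j + y j) powr p) \<le> (A + B) powr p"
    using ab by simp
  then have "(\<Sum>j. norm (x j + y j) powr p) powr (1 / p) \<le> ((A + B) powr p) powr (1 / p)"
    using p s by (intro powr_mono2 suminf_nonneg) auto
  then show "lp_norm p (\<lambda>j. x j + y j) \<le> A + B"
    using A B p by (simp add: lp_norm_def powr_powr)
qed

lemma lp_add:
  assumes "p \<ge> 1" "x \<in> lp p" "y \<in> lp p"
  shows "(\<lambda>j. x j + y j) \<in> lp p"
    and lp_norm_triangle: "lp_norm p (\<lambda>j. x j + y j) \<le> lp_norm p x + lp_norm p y"
proof -
  have nn: "lp_norm p z \<ge> 0" for z
    by (simp add: lp_norm_def)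
  have pos: "0 < lp_norm p z + e" if "e > 0" for z e
    using nn[of z] that by linarith
  show "(\<lambda>j. x j + y j) \<in> lp p"
    by (rule lp_add_aux(1)[OF assms pos[of 1 x] _ pos[of 1 y]]) auto
  show "lp_norm p (\<lambda>j. x j + y j) \<le> lp_norm p x + lp_norm p y"
  proof (rule field_le_epsilon)
    fix e :: real assume "e > 0"
    then show "lp_norm p (\<lambda>j. x j + y j) \<le> lp_norm p x + lp_norm p y + e"
      using lp_add_aux(2)[OF assms pos[of "e/2" x] _ pos[of "e/2" y]] by auto
  qed
qed

lemma lp_minus: "x \<in> lp p \<Longrightarrow> (\<lambda>j. - x j) \<in> lp p"
  by (simp add: lp_def)

lemma lp_diff:
  assumes "p \<ge> 1" "x \<in> lp p" "y \<in> lp p"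
  shows "(\<lambda>j. x j - y j) \<in> lp p"
  using lp_add(1)[OF assms(1,2) lp_minus[OF assms(3)]] by simp

lemma lp_norm_eq_0_iff:
  assumes "p \<ge> 1" "x \<in> lp p"
  shows "lp_norm p x = 0 \<longleftrightarrow> x = (\<lambda>j. 0)"
  using assms by (auto simp: lp_norm_def lp_def suminf_eq_zero_iff)

lemma Metric_space_lp:
  assumes p: "p \<ge> 1"
  shows "Metric_space (lp p) (lp_dist p)"
proof
  fix x y z
  show "0 \<le> lp_dist p x y"
    by (simp add: lp_dist_def lp_norm_def)
  show "lp_dist p x y = lp_dist p y x"
    by (simp add: lp_dist_def lp_norm_def norm_minus_commute)
  assume x: "x \<in> lp p" and y: "y \<in> lp p"
  show "(lp_dist p x y = 0) = (x = y)"
    using lp_norm_eq_0_iff[OF p lp_diff[OF p x y]] by (auto simp: lp_dist_def fun_eq_iff)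
  assume z: "z \<in> lp p"
  show "lp_dist p x z \<le> lp_dist p x y + lp_dist p y z"
    using lp_norm_triangle[OF p lp_diff[OF p x y] lp_diff[OF p y z]]
    by (simp add: lp_dist_def)
qed

end

theory Submission
  imports Defs
begin

text \<open>
  Write \<open>W(x) = \<langle>T x, J x\<rangle>\<close> and let \<open>P\<^sub>n\<close>, \<open>Q\<^sub>n = 1 - P\<^sub>n\<close> be the projections of a sequence onto its
  first \<open>n\<close> coordinates and onto the remaining ones (\<open>head n\<close> and \<open>tail n\<close>).

  That the essential numerical range is contained in every closure rests on the fact that a compact
  operator maps weakly null sequences to norm null sequences
  (\<open>compact_operator_weakly_null\<close>): along a weakly null sequence of unit vectors the contribution of
  \<open>K\<close> to the values of \<open>T + K\<close> vanishes.

  For the other inclusion let \<open>l\<close> lie in all the closures. Since unit vectors \<open>x\<^sub>n\<close> in the range of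
  \<open>Q\<^sub>n\<close> are automatically weakly null, it is enough to find such vectors with \<open>W(x\<^sub>n)\<close> close to \<open>l\<close>.
  For every scalar \<open>c\<close> the operator \<open>Q\<^sub>n T Q\<^sub>n + c P\<^sub>n\<close> is a finite rank perturbation of \<open>T\<close>, and
  because \<open>J\<close> acts coordinatewise its value at a unit vector \<open>x\<close> is \<open>W(Q\<^sub>n x) + (1 - t) c\<close> with
  \<open>t = \<parallel>Q\<^sub>n x\<parallel>\<^sup>p\<close>; as \<open>W\<close> is homogeneous of degree \<open>p\<close>, this is a convex combination of \<open>c\<close> and a value
  of \<open>W\<close> at a unit vector of the range of \<open>Q\<^sub>n\<close>. With \<open>c = l + d\<close>, where \<open>\<bar>d\<bar> = 1\<close>, it follows that \<open>W\<close>
  takes on that range a value close to some \<open>l - r d\<close> with \<open>r \<ge> 0\<close>: the value lies on the ray that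
  leaves \<open>l\<close> away from \<open>c\<close> (\<open>tail_form_on_ray\<close>).

  The numerical range on \<open>\<ell>\<^sub>p\<close> is in general not convex, but far out it behaves as if it were
  (\<open>asymptotic_convexity\<close>): if \<open>x\<close> has finite support and \<open>y\<close> is supported far beyond it, then the
  cross terms \<open>\<langle>T x, J y\<rangle>\<close> and \<open>\<langle>T y, J x\<rangle>\<close> are small and \<open>W(a x + b y)\<close> is close to
  \<open>a\<^sup>p W(x) + b\<^sup>p W(y)\<close>. The directions \<open>d = 1\<close> and \<open>d = -1\<close> provide values close to \<open>l - r\<close> and \<open>l + s\<close>
  with \<open>r, s \<ge> 0\<close>, and \<open>l\<close> lies on the segment between these two points.
\<close>

section \<open>Coordinate projections and norms of sequences\<close>

lemma lp_norm_nonneg [simp]: "0 \<le> lp_norm p x"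
  by (simp add: lp_norm_def)

lemma lp_norm_powr:
  assumes "p > 0" "x \<in> lp p"
  shows "lp_norm p x powr p = (\<Sum>j. norm (x j) powr p)"
proof -
  have "0 \<le> (\<Sum>j. norm (x j) powr p)"
    using assms by (intro suminf_nonneg) (auto simp: lp_def)
  then show ?thesis
    using assms by (simp add: lp_norm_def powr_powr)
qed

lemma lp_norm_eqI:
  assumes "p > 0" "C \<ge> 0" "(\<lambda>j. norm (x j) powr p) sums (C powr p)"
  shows "x \<in> lp p" "lp_norm p x = C"
  using assms by (auto simp: lp_def lp_norm_def sums_iff powr_powr)

lemma lp_dominated:
  assumes "p > 0" "y \<in> lp p" "\<And>j. norm (x j) \<le> norm (y j)"
  shows "x \<in> lp p" "lp_norm p x \<le> lp_norm p y"
proof -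
  have le: "norm (x j) powr p \<le> norm (y j) powr p" for j
    using assms by (intro powr_mono2) auto
  have sy: "summable (\<lambda>j. norm (y j) powr p)"
    using assms by (simp add: lp_def)
  have sx: "summable (\<lambda>j. norm (x j) powr p)"
    by (rule summable_comparison_test'[OF sy, of 0]) (use le in auto)
  then show "x \<in> lp p"
    by (simp add: lp_def)
  show "lp_norm p x \<le> lp_norm p y"
    unfolding lp_norm_def
    using assms sx sy le by (intro powr_mono2 suminf_le suminf_nonneg) auto
qed

lemma lp_zero [simp]: "(\<lambda>j. 0) \<in> lp p" "lp_norm p (\<lambda>j. 0) = 0"
  by (auto simp: lp_def lp_norm_def)

lemma lp_scale:
  assumes "p > 0" "x \<in> lp p"
  shows "(\<lambda>j. c * x j) \<in> lp p" "lp_norm p (\<lambda>j. c * x j) = norm c * lp_norm p x"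
proof -
  have "(\<lambda>j. norm c powr p * norm (x j) powr p) sums (norm c powr p * (lp_norm p x powr p))"
    using assms by (intro sums_mult) (simp add: lp_norm_powr lp_def summable_sums)
  then have *: "(\<lambda>j. norm (c * x j) powr p) sums ((norm c * lp_norm p x) powr p)"
    by (simp add: norm_mult powr_mult)
  show "(\<lambda>j. c * x j) \<in> lp p" "lp_norm p (\<lambda>j. c * x j) = norm c * lp_norm p x"
    using lp_norm_eqI[OF assms(1) _ *] by auto
qed

lemma norm_le_lp_norm:
  assumes "p > 0" "x \<in> lp p"
  shows "norm (x j) \<le> lp_norm p x"
proof -
  have "norm (x j) powr p \<le> (\<Sum>j. norm (x j) powr p)"
    using assms sum_le_suminf[of "\<lambda>j. norm (x j) powr p" "{j}"] by (auto simp: lp_def)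
  then have "norm (x j) powr p \<le> lp_norm p x powr p"
    using assms by (simp add: lp_norm_powr)
  then show ?thesis
    using assms by (meson lp_norm_nonneg norm_ge_zero not_le powr_less_mono2)
qed

definition head :: "nat \<Rightarrow> (nat \<Rightarrow> complex) \<Rightarrow> nat \<Rightarrow> complex" where
  "head n x = (\<lambda>j. if j < n then x j else 0)"

definition tail :: "nat \<Rightarrow> (nat \<Rightarrow> complex) \<Rightarrow> nat \<Rightarrow> complex" where
  "tail n x = (\<lambda>j. if j < n then 0 else x j)"

lemma head_plus_tail: "(\<lambda>j. head n x j + tail n x j) = x"
  by (auto simp: head_def tail_def)

lemma head_lp [simp]: "p > 0 \<Longrightarrow> head n x \<in> lp p"
  unfolding lp_def head_def
  by (auto intro!: summable_finite[of "{..<n}"] split: if_splits)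

lemma tail_lp [simp]: "p > 0 \<Longrightarrow> x \<in> lp p \<Longrightarrow> tail n x \<in> lp p"
  by (rule lp_dominated(1)[of p x]) (auto simp: tail_def)

lemma lp_norm_tail_le: "p > 0 \<Longrightarrow> x \<in> lp p \<Longrightarrow> lp_norm p (tail n x) \<le> lp_norm p x"
  by (rule lp_dominated(2)[of p x]) (auto simp: tail_def)

lemma lp_norm_head_le: "p > 0 \<Longrightarrow> x \<in> lp p \<Longrightarrow> lp_norm p (head n x) \<le> lp_norm p x"
  by (rule lp_dominated(2)[of p x]) (auto simp: head_def)

lemma lp_norm_tail_tendsto_0:
  assumes "p > 0" "x \<in> lp p"
  shows "(\<lambda>n. lp_norm p (tail n x)) \<longlonglongrightarrow> 0"
proof -
  let ?f = "\<lambda>j. norm (x j) powr p"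
  have s: "summable ?f"
    using assms by (simp add: lp_def)
  have "(\<lambda>n. suminf ?f - (\<Sum>j<n. ?f j)) \<longlonglongrightarrow> suminf ?f - suminf ?f"
    by (intro tendsto_diff tendsto_const summable_LIMSEQ s)
  moreover have "lp_norm p (tail n x) powr p = suminf ?f - (\<Sum>j<n. ?f j)" for n
  proof -
    have "(\<lambda>j. ?f j - (if j \<in> {..<n} then ?f j else 0)) sums (suminf ?f - (\<Sum>j\<in>{..<n}. ?f j))"
      by (intro sums_diff summable_sums s sums_If_finite_set) auto
    also have "(\<lambda>j. ?f j - (if j \<in> {..<n} then ?f j else 0)) = (\<lambda>j. norm (tail n x j) powr p)"
      by (auto simp: tail_def)
    finally show ?thesis
      using assms by (simp add: lp_norm_powr sums_iff)
  qed
  ultimately have "(\<lambda>n. lp_norm p (tail n x) powr p) \<longlonglongrightarrow> 0"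
    by simp
  then have "(\<lambda>n. (lp_norm p (tail n x) powr p) powr (1/p)) \<longlonglongrightarrow> 0 powr (1/p)"
    using assms by (intro tendsto_powr') auto
  then show ?thesis
    using assms by (simp add: powr_powr)
qed

text \<open>
  The \<open>p\<close>-th power of the norm is additive on disjoint supports. It turns the norm condition
  \<open>\<parallel>a x + b y\<parallel> = 1\<close> for such unit vectors into \<open>a\<^sup>p + b\<^sup>p = 1\<close>, so that \<open>a\<^sup>p\<close> and \<open>b\<^sup>p\<close> can serve as
  the weights of a convex combination.
\<close>

lemma lp_norm_disjoint_add:
  assumes "p > 0" "x \<in> lp p" "y \<in> lp p" "\<And>j. x j = 0 \<or> y j = 0"
  shows "lp_norm p (\<lambda>j. x j + y j) powr p = lp_norm p x powr p + lp_norm p y powr p"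
proof -
  have eq: "(\<lambda>j. norm (x j) powr p + norm (y j) powr p) = (\<lambda>j. norm (x j + y j) powr p)"
    using assms(4) by (metis (no_types, opaque_lifting) add_0 add_0_right norm_zero powr_0)
  have s: "(\<lambda>j. norm (x j) powr p + norm (y j) powr p) sums
      (lp_norm p x powr p + lp_norm p y powr p)"
    using assms by (intro sums_add) (auto simp: lp_norm_powr lp_def summable_sums)
  then have "(\<lambda>j. x j + y j) \<in> lp p"
    unfolding eq by (auto simp: lp_def sums_iff)
  then show ?thesis
    using s assms unfolding eq by (simp add: lp_norm_powr sums_iff)
qed

lemma head_tail_disjoint: "head n x j = 0 \<or> tail n x j = 0"
  by (simp add: head_def tail_def)

lemma lp_norm_head_tail:
  assumes "p > 0" "x \<in> lp p"
  shows "lp_norm p (head n x) powr p + lp_norm p (tail n x) powr p = lp_norm p x powr p"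
  using lp_norm_disjoint_add[OF assms(1) head_lp[OF assms(1)] tail_lp[OF assms] head_tail_disjoint]
  by (simp add: head_plus_tail)

section \<open>Bounded and compact operators\<close>

lemma lp_operatorsD:
  assumes "T \<in> lp_operators p"
  shows "x \<in> lp p \<Longrightarrow> T x \<in> lp p"
    and "x \<in> lp p \<Longrightarrow> y \<in> lp p \<Longrightarrow> T (\<lambda>j. x j + y j) = (\<lambda>j. T x j + T y j)"
    and "x \<in> lp p \<Longrightarrow> T (\<lambda>j. c * x j) = (\<lambda>j. c * T x j)"
  using assms by (auto simp: lp_operators_def)

lemma lp_operators_bound:
  assumes "T \<in> lp_operators p"
  obtains C where "C > 0" "\<And>x. x \<in> lp p \<Longrightarrow> lp_norm p (T x) \<le> C * lp_norm p x"
proof -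
  obtain C where C: "\<And>x. x \<in> lp p \<Longrightarrow> lp_norm p (T x) \<le> C * lp_norm p x"
    using assms unfolding lp_operators_def by blast
  have "lp_norm p (T x) \<le> (\<bar>C\<bar> + 1) * lp_norm p x" if "x \<in> lp p" for x
    using C[OF that] mult_right_mono[of C "\<bar>C\<bar> + 1" "lp_norm p x"] by force
  then show ?thesis
    using that[of "\<bar>C\<bar> + 1"] by auto
qed

lemma lp_operatorsI:
  assumes "\<And>x. x \<in> lp p \<Longrightarrow> T x \<in> lp p"
    and "\<And>x y. x \<in> lp p \<Longrightarrow> y \<in> lp p \<Longrightarrow> T (\<lambda>j. x j + y j) = (\<lambda>j. T x j + T y j)"
    and "\<And>c x. x \<in> lp p \<Longrightarrow> T (\<lambda>j. c * x j) = (\<lambda>j. c * T x j)"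
    and "\<And>x. x \<in> lp p \<Longrightarrow> lp_norm p (T x) \<le> C * lp_norm p x"
  shows "T \<in> lp_operators p"
  unfolding lp_operators_def using assms by blast

lemma lp_operators_add:
  assumes "p \<ge> 1" "S \<in> lp_operators p" "T \<in> lp_operators p"
  shows "(\<lambda>x j. S x j + T x j) \<in> lp_operators p"
proof -
  obtain C where C: "\<And>x. x \<in> lp p \<Longrightarrow> lp_norm p (S x) \<le> C * lp_norm p x"
    using lp_operators_bound[OF assms(2)] by blast
  obtain D where D: "\<And>x. x \<in> lp p \<Longrightarrow> lp_norm p (T x) \<le> D * lp_norm p x"
    using lp_operators_bound[OF assms(3)] by blast
  note S = lp_operatorsD[OF assms(2)] and T = lp_operatorsD[OF assms(3)]
  show ?thesis
  proof (rule lp_operatorsI[where C = "C + D"])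
    fix x assume x: "x \<in> lp p"
    show "(\<lambda>j. S x j + T x j) \<in> lp p"
      by (intro lp_add assms S T x)
    show "lp_norm p (\<lambda>j. S x j + T x j) \<le> (C + D) * lp_norm p x"
      using lp_norm_triangle[OF assms(1) S(1)[OF x] T(1)[OF x]] C[OF x] D[OF x]
      by (simp add: distrib_right)
  qed (simp_all add: S T algebra_simps)
qed

lemma lp_operators_id: "(\<lambda>x. x) \<in> lp_operators p"
  by (rule lp_operatorsI[where C = 1]) auto

lemma lp_operators_scale:
  assumes "p > 0" "T \<in> lp_operators p"
  shows "(\<lambda>x j. c * T x j) \<in> lp_operators p"
proof -
  note T = lp_operatorsD[OF assms(2)]
  obtain C where C: "\<And>x. x \<in> lp p \<Longrightarrow> lp_norm p (T x) \<le> C * lp_norm p x"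
    using lp_operators_bound[OF assms(2)] by blast
  show ?thesis
  proof (rule lp_operatorsI[where C = "norm c * C"])
    fix x assume x: "x \<in> lp p"
    show "lp_norm p (\<lambda>j. c * T x j) \<le> norm c * C * lp_norm p x"
      using mult_left_mono[OF C[OF x], of "norm c"]
      by (simp add: lp_scale[OF assms(1) T(1)[OF x]] mult.assoc)
  qed (use assms T in \<open>auto simp: lp_scale algebra_simps\<close>)
qed

lemma lp_operators_head_right:
  assumes "p > 0" "T \<in> lp_operators p"
  shows "(\<lambda>x. T (head n x)) \<in> lp_operators p"
proof -
  note T = lp_operatorsD[OF assms(2)]
  obtain C where C: "C > 0" "\<And>x. x \<in> lp p \<Longrightarrow> lp_norm p (T x) \<le> C * lp_norm p x"
    using lp_operators_bound[OF assms(2)] by blast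
  have add: "head n (\<lambda>j. x j + y j) = (\<lambda>j. head n x j + head n y j)" for x y
    by (auto simp: head_def)
  have scale: "head n (\<lambda>j. c * x j) = (\<lambda>j. c * head n x j)" for c x
    by (auto simp: head_def)
  show ?thesis
  proof (rule lp_operatorsI[where C = C])
    fix x assume x: "x \<in> lp p"
    have "lp_norm p (T (head n x)) \<le> C * lp_norm p (head n x)"
      using C assms by simp
    also have "\<dots> \<le> C * lp_norm p x"
      using C lp_norm_head_le[OF assms(1) x] by simp
    finally show "lp_norm p (T (head n x)) \<le> C * lp_norm p x" .
  qed (use assms T in \<open>simp_all add: add scale\<close>)
qed

text \<open>
  Bolzano-Weierstrass: in a metric space the closure of a set is compact precisely when sequences in
  the set have convergent subsequences.
\<close>

lemma lp_compact_operators_iff: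
  assumes "p \<ge> 1"
  shows "K \<in> lp_compact_operators p \<longleftrightarrow> K \<in> lp_operators p \<and>
    (\<forall>x. (\<forall>n::nat. x n \<in> lp p \<and> lp_norm p (x n) \<le> 1) \<longrightarrow>
      (\<exists>l\<in>lp p. \<exists>r. strict_mono r \<and>
        (\<lambda>n. lp_norm p (\<lambda>j. K (x (r n)) j - l j)) \<longlonglongrightarrow> 0))"
    (is "_ \<longleftrightarrow> _ \<and> ?R")
proof (cases "K \<in> lp_operators p")
  case True
  interpret Metric_space "lp p" "lp_dist p"
    by (rule Metric_space_lp[OF assms])
  let ?S = "K ` {x \<in> lp p. lp_norm p x \<le> 1}"
  have K: "x \<in> lp p \<Longrightarrow> K x \<in> lp p" for x
    using lp_operatorsD(1)[OF True] .
  have S: "?S \<subseteq> lp p"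
    using K by auto
  have D: "lp p \<inter> mtopology derived_set_of T = mtopology derived_set_of T" for T
    using derived_set_of_subset_topspace[of mtopology T] by auto
  have "K \<in> lp_compact_operators p \<longleftrightarrow>
      (\<forall>T. infinite T \<and> T \<subseteq> ?S \<and> T \<subseteq> lp p \<longrightarrow> mtopology derived_set_of T \<noteq> {})"
    unfolding compact_closure_of_eq_Bolzano_Weierstrass[symmetric]
    using True by (simp add: lp_compact_operators_def lp_topology_def)
  also have "\<dots> \<longleftrightarrow> (\<forall>T. T \<subseteq> ?S \<and> infinite T \<longrightarrow> lp p \<inter> mtopology derived_set_of T \<noteq> {})"
    unfolding D using S by (meson subset_trans)
  also have "\<dots> \<longleftrightarrow> (\<forall>\<sigma>::nat \<Rightarrow> _. range \<sigma> \<subseteq> ?S \<longrightarrow>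
      (\<exists>l r. l \<in> lp p \<and> strict_mono r \<and> limitin mtopology (\<sigma> \<circ> r) l sequentially))"
    by (rule Bolzano_Weierstrass_property[OF S S, symmetric])
  also have "\<dots> \<longleftrightarrow> ?R"
  proof safe
    fix x assume *: "\<forall>\<sigma>::nat \<Rightarrow> _. range \<sigma> \<subseteq> ?S \<longrightarrow>
      (\<exists>l r. l \<in> lp p \<and> strict_mono r \<and> limitin mtopology (\<sigma> \<circ> r) l sequentially)"
      and x: "\<forall>n::nat. x n \<in> lp p \<and> lp_norm p (x n) \<le> 1"
    then have "range (\<lambda>n. K (x n)) \<subseteq> ?S"
      by auto
    then obtain l r where "l \<in> lp p" "strict_mono r"
        "limitin mtopology ((\<lambda>n. K (x n)) \<circ> r) l sequentially"
      using * by meson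
    then show "\<exists>l\<in>lp p. \<exists>r. strict_mono r \<and>
        (\<lambda>n. lp_norm p (\<lambda>j. K (x (r n)) j - l j)) \<longlonglongrightarrow> 0"
      by (auto simp: limitin_metric_dist_null lp_dist_def o_def)
  next
    fix \<sigma> :: "nat \<Rightarrow> nat \<Rightarrow> complex"
    assume *: ?R and \<sigma>: "range \<sigma> \<subseteq> ?S"
    then have "\<forall>n. \<exists>y. y \<in> lp p \<and> lp_norm p y \<le> 1 \<and> \<sigma> n = K y"
      by blast
    then obtain x where x: "\<And>n. x n \<in> lp p \<and> lp_norm p (x n) \<le> 1" "\<And>n. \<sigma> n = K (x n)"
      by metis
    then obtain l r where lr: "l \<in> lp p" "strict_mono r"
        "(\<lambda>n. lp_norm p (\<lambda>j. K (x (r n)) j - l j)) \<longlonglongrightarrow> 0"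
      using * by blast
    then have "limitin mtopology (\<sigma> \<circ> r) l sequentially"
      using x K by (auto simp: limitin_metric_dist_null lp_dist_def o_def)
    then show "\<exists>l r. l \<in> lp p \<and> strict_mono r \<and> limitin mtopology (\<sigma> \<circ> r) l sequentially"
      using lr by blast
  qed
  finally show ?thesis
    using True by blast
qed (simp add: lp_compact_operators_def)

lemma lp_compact_operators_zero:
  assumes "p \<ge> 1"
  shows "(\<lambda>x j. 0) \<in> lp_compact_operators p"
  unfolding lp_compact_operators_iff[OF assms]
proof (intro conjI allI impI bexI exI)
  show "(\<lambda>x j. 0) \<in> lp_operators p"
    by (rule lp_operatorsI[where C = 0]) auto
  show "strict_mono (id :: nat \<Rightarrow> nat)"
    by (rule strict_mono_id)
  show "(\<lambda>j. 0) \<in> lp p" by simp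
qed simp

lemma lp_compact_operators_add:
  assumes p: "p \<ge> 1" and K: "K \<in> lp_compact_operators p" and L: "L \<in> lp_compact_operators p"
  shows "(\<lambda>x j. K x j + L x j) \<in> lp_compact_operators p"
  unfolding lp_compact_operators_iff[OF p]
proof (intro conjI allI impI)
  note K' = K[unfolded lp_compact_operators_iff[OF p]] and L' = L[unfolded lp_compact_operators_iff[OF p]]
  note Kop = K'[THEN conjunct1] and Lop = L'[THEN conjunct1]
  show "(\<lambda>x j. K x j + L x j) \<in> lp_operators p"
    by (intro lp_operators_add p Kop Lop)
  fix x assume x: "\<forall>n::nat. x n \<in> lp p \<and> lp_norm p (x n) \<le> 1"
  obtain k r where k: "k \<in> lp p" "strict_mono r"
      "(\<lambda>n. lp_norm p (\<lambda>j. K (x (r n)) j - k j)) \<longlonglongrightarrow> 0"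
    using K' x by blast
  have "\<forall>n. x (r n) \<in> lp p \<and> lp_norm p (x (r n)) \<le> 1"
    using x by blast
  then obtain l s where l: "l \<in> lp p" "strict_mono s"
      "(\<lambda>n. lp_norm p (\<lambda>j. L (x (r (s n))) j - l j)) \<longlonglongrightarrow> 0"
    using L'[THEN conjunct2, rule_format, of "\<lambda>n. x (r n)"] by blast
  have "(\<lambda>n. lp_norm p (\<lambda>j. K (x (r (s n))) j - k j)) \<longlonglongrightarrow> 0"
    using LIMSEQ_subseq_LIMSEQ[OF k(3) l(2)] by (simp add: o_def)
  from tendsto_add[OF this l(3)]
  have sum0: "(\<lambda>n. lp_norm p (\<lambda>j. K (x (r (s n))) j - k j) +
      lp_norm p (\<lambda>j. L (x (r (s n))) j - l j)) \<longlonglongrightarrow> 0"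
    by simp
  have "(\<lambda>n. lp_norm p (\<lambda>j. (K (x (r (s n))) j + L (x (r (s n))) j) - (k j + l j))) \<longlonglongrightarrow> 0"
  proof (rule Lim_null_comparison[OF _ sum0], rule always_eventually, rule allI)
    fix n
    have "lp_norm p (\<lambda>j. (K (x (r (s n))) j - k j) + (L (x (r (s n))) j - l j))
        \<le> lp_norm p (\<lambda>j. K (x (r (s n))) j - k j) + lp_norm p (\<lambda>j. L (x (r (s n))) j - l j)"
      using x k l by (intro lp_norm_triangle lp_diff p lp_operatorsD[OF Kop] lp_operatorsD[OF Lop]) auto
    then show "norm (lp_norm p (\<lambda>j. (K (x (r (s n))) j + L (x (r (s n))) j) - (k j + l j))) \<le>
        lp_norm p (\<lambda>j. K (x (r (s n))) j - k j) + lp_norm p (\<lambda>j. L (x (r (s n))) j - l j)"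
      by (simp add: algebra_simps)
  qed
  then show "\<exists>m\<in>lp p. \<exists>t. strict_mono t \<and>
      (\<lambda>n. lp_norm p (\<lambda>j. (K (x (t n)) j + L (x (t n)) j) - m j)) \<longlonglongrightarrow> 0"
    using lp_add(1)[OF p k(1) l(1)] strict_mono_o[OF k(2) l(2)]
    by (intro bexI[of _ "\<lambda>j. k j + l j"] exI[of _ "r \<circ> s"]) auto
qed

section \<open>Functionals and finite rank operators\<close>

definition lp_functionals :: "real \<Rightarrow> ((nat \<Rightarrow> complex) \<Rightarrow> complex) set" where
  "lp_functionals p = {f.
     (\<forall>x\<in>lp p. \<forall>y\<in>lp p. f (\<lambda>j. x j + y j) = f x + f y) \<and>
     (\<forall>c. \<forall>x\<in>lp p. f (\<lambda>j. c * x j) = c * f x) \<and>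
     (\<exists>C. \<forall>x\<in>lp p. norm (f x) \<le> C * lp_norm p x)}"

lemma lp_functionalsD:
  assumes "f \<in> lp_functionals p"
  shows "x \<in> lp p \<Longrightarrow> y \<in> lp p \<Longrightarrow> f (\<lambda>j. x j + y j) = f x + f y"
    and "x \<in> lp p \<Longrightarrow> f (\<lambda>j. c * x j) = c * f x"
    and "\<exists>C. \<forall>x\<in>lp p. norm (f x) \<le> C * lp_norm p x"
  using assms by (auto simp: lp_functionals_def)

definition basis :: "nat \<Rightarrow> nat \<Rightarrow> complex" where
  "basis i = (\<lambda>j. if j = i then 1 else 0)"

lemma basis_lp [simp]: "basis i \<in> lp p"
  by (auto simp: lp_def basis_def intro!: summable_finite[of "{i}"] split: if_splits)

text \<open>
  A functional is determined on finitely supported sequences by its values on the unit vectors. For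
  the coordinate functionals of an operator this also exhibits \<open>T P\<^sub>n\<close> as a finite rank operator.
\<close>

lemma lp_functional_head:
  assumes p: "p > 0" and f: "f \<in> lp_functionals p"
  shows "f (head n x) = (\<Sum>j<n. x j * f (basis j))"
proof (induction n)
  case 0
  show ?case
    using lp_functionalsD(2)[OF f lp_zero(1), of 0] by (simp add: head_def)
next
  case (Suc n)
  have "f (\<lambda>i. head n x i + x n * basis n i) = f (head n x) + f (\<lambda>i. x n * basis n i)"
    using p by (intro lp_functionalsD(1)[OF f] lp_scale(1)) auto
  also have "f (\<lambda>i. x n * basis n i) = x n * f (basis n)"
    by (rule lp_functionalsD(2)[OF f basis_lp])
  also have "(\<lambda>i. head n x i + x n * basis n i) = head (Suc n) x"
    by (auto simp: head_def basis_def fun_eq_iff less_Suc_eq)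
  finally show ?case
    using Suc by simp
qed

lemma lp_functional_coordinate:
  assumes p: "p > 0" and T: "T \<in> lp_operators p"
  shows "(\<lambda>x. T x i) \<in> lp_functionals p"
proof -
  obtain C where "\<And>x. x \<in> lp p \<Longrightarrow> lp_norm p (T x) \<le> C * lp_norm p x"
    using lp_operators_bound[OF T] by blast
  then have "norm (T x i) \<le> C * lp_norm p x" if "x \<in> lp p" for x
    using that norm_le_lp_norm[OF p lp_operatorsD(1)[OF T that]] by (meson order_trans)
  then show ?thesis
    using lp_operatorsD[OF T] by (auto simp: lp_functionals_def)
qed

text \<open>
  The values of a bounded functional on the unit ball stay in a compact disc, and a convergent
  subsequence of these scalars gives a convergent subsequence of the multiples of \<open>u\<close>.
\<close>

lemma lp_compact_operators_rank_one:
  assumes p: "p \<ge> 1" and f: "f \<in> lp_functionals p" and u: "u \<in> lp p"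
  shows "(\<lambda>x j. f x * u j) \<in> lp_compact_operators p"
  unfolding lp_compact_operators_iff[OF p]
proof (intro conjI allI impI)
  have p0: "p > 0" using p by simp
  obtain C where C: "\<And>x. x \<in> lp p \<Longrightarrow> norm (f x) \<le> C * lp_norm p x"
    using f unfolding lp_functionals_def by blast
  show "(\<lambda>x j. f x * u j) \<in> lp_operators p"
  proof (rule lp_operatorsI[where C = "C * lp_norm p u"])
    fix x assume x: "x \<in> lp p"
    show "(\<lambda>j. f x * u j) \<in> lp p"
      by (rule lp_scale[OF p0 u])
    show "lp_norm p (\<lambda>j. f x * u j) \<le> C * lp_norm p u * lp_norm p x"
      using mult_right_mono[OF C[OF x], of "lp_norm p u"]
      by (simp add: lp_scale[OF p0 u] mult_ac)
  qed (use f in \<open>auto simp: lp_functionals_def algebra_simps\<close>)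
  fix x assume x: "\<forall>n::nat. x n \<in> lp p \<and> lp_norm p (x n) \<le> 1"
  have "f (x n) \<in> cball 0 \<bar>C\<bar>" for n
  proof -
    have "C * lp_norm p (x n) \<le> \<bar>C\<bar> * 1"
      using x by (intro mult_mono) auto
    then show ?thesis
      using C[of "x n"] x by (auto intro: order_trans)
  qed
  then obtain l r where l: "strict_mono r" "((\<lambda>n. f (x n)) \<circ> r) \<longlonglongrightarrow> l"
    using compact_cball[of 0 "\<bar>C\<bar>"] unfolding compact_def by metis
  have "(\<lambda>n. norm (f (x (r n)) - l) * lp_norm p u) \<longlonglongrightarrow> 0 * lp_norm p u"
    using l(2) by (intro tendsto_mult tendsto_const tendsto_norm_zero) (simp add: o_def LIM_zero)
  moreover have "lp_norm p (\<lambda>j. f (x (r n)) * u j - l * u j) = norm (f (x (r n)) - l) * lp_norm p u" for n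
    using lp_scale(2)[OF p0 u, of "f (x (r n)) - l"] by (simp add: algebra_simps)
  ultimately show "\<exists>m\<in>lp p. \<exists>t. strict_mono t \<and>
      (\<lambda>n. lp_norm p (\<lambda>j. f (x (t n)) * u j - m j)) \<longlonglongrightarrow> 0"
    using l(1) lp_scale(1)[OF p0 u, of l]
    by (intro bexI[of _ "\<lambda>j. l * u j"] exI[of _ r]) auto
qed

lemma lp_compact_operators_finite_rank:
  fixes n :: nat
  assumes p: "p \<ge> 1" and f: "\<And>i. i < n \<Longrightarrow> f i \<in> lp_functionals p"
    and u: "\<And>i. i < n \<Longrightarrow> u i \<in> lp p"
  shows "(\<lambda>x j. \<Sum>i<n. f i x * u i j) \<in> lp_compact_operators p"
  using f u
proof (induction n)
  case 0
  then show ?case using lp_compact_operators_zero[OF p] by simp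
next
  case (Suc n)
  then show ?case
    using lp_compact_operators_add[OF p Suc.IH lp_compact_operators_rank_one[OF p, of "f n" "u n"]]
    by simp
qed

lemma lp_compact_operators_head_left:
  assumes "p \<ge> 1" "T \<in> lp_operators p"
  shows "(\<lambda>x. head n (T x)) \<in> lp_compact_operators p"
proof -
  have "(\<lambda>x j. \<Sum>i<n. T x i * basis i j) \<in> lp_compact_operators p"
    by (rule lp_compact_operators_finite_rank) (use assms in \<open>auto intro: lp_functional_coordinate\<close>)
  also have "(\<lambda>x j. \<Sum>i<n. T x i * basis i j) = (\<lambda>x. head n (T x))"
    by (auto simp: fun_eq_iff head_def basis_def if_distrib cong: if_cong)
  finally show ?thesis .
qed

lemma lp_compact_operators_head_right:
  assumes "p \<ge> 1" "T \<in> lp_operators p"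
  shows "(\<lambda>x. T (head n x)) \<in> lp_compact_operators p"
proof -
  have "(\<lambda>x j. \<Sum>i<n. x i * T (basis i) j) \<in> lp_compact_operators p"
    by (rule lp_compact_operators_finite_rank)
      (use assms in \<open>auto intro: lp_functional_coordinate[OF _ lp_operators_id] lp_operatorsD\<close>)
  also have "(\<lambda>x j. \<Sum>i<n. x i * T (basis i) j) = (\<lambda>x. T (head n x))"
    using lp_functional_head[OF _ lp_functional_coordinate[OF _ assms(2)]] assms(1)
    by (auto simp: fun_eq_iff)
  finally show ?thesis .
qed

section \<open>The duality map and the pairing\<close>

lemma norm_lp_J: "norm (lp_J p x j) = norm (x j) powr (p - 1)"
proof (cases "x j = 0")
  case False
  then have "norm (x j) * norm (x j) powr (p - 2) = norm (x j) powr (p - 1)"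
    using powr_add[of "norm (x j)" 1 "p - 2"] by simp
  then show ?thesis
    using False by (simp add: lp_J_def norm_mult)
qed (simp add: lp_J_def)

lemma mult_cnj_lp_J: "x j * cnj (lp_J p x j) = of_real (norm (x j) powr p)"
proof (cases "x j = 0")
  case False
  then have "norm (x j) ^ 2 * norm (x j) powr (p - 2) = norm (x j) powr p"
    by (simp flip: powr_add powr_numeral)
  moreover have "x j * cnj (lp_J p x j) = of_real (norm (x j) ^ 2 * norm (x j) powr (p - 2))"
    using complex_norm_square[of "x j"] by (simp add: lp_J_def)
  ultimately show ?thesis
    by simp
qed (simp add: lp_J_def)

text \<open>
  Homogeneity of degree \<open>p - 1\<close>. The value \<open>a = 0\<close> is covered because \<open>0 powr (p - 1) = 0\<close> for every
  \<open>p\<close>.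
\<close>

lemma lp_J_scale:
  assumes "a \<ge> 0"
  shows "lp_J p (\<lambda>j. of_real a * x j) = (\<lambda>j. of_real (a powr (p - 1)) * lp_J p x j)"
proof (cases "a = 0")
  case False
  then have a: "a * a powr (p - 2) = a powr (p - 1)"
    using powr_add[of a 1 "p - 2"] assms by simp
  have "lp_J p (\<lambda>j. of_real a * x j) j =
      of_real (a * a powr (p - 2)) * lp_J p x j" for j
    using assms by (simp add: lp_J_def norm_mult powr_mult)
  then show ?thesis
    unfolding a by auto
qed (auto simp: lp_J_def)

text \<open>
  Although \<open>J\<close> is nonlinear for \<open>p \<noteq> 2\<close>, it acts coordinatewise and is therefore additive on disjoint
  supports. All decompositions of vectors below are of this kind.
\<close>

lemma lp_J_disjoint_add:
  assumes "\<And>j. x j = 0 \<or> y j = 0"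
  shows "lp_J p (\<lambda>j. x j + y j) = (\<lambda>j. lp_J p x j + lp_J p y j)"
proof
  fix j show "lp_J p (\<lambda>j. x j + y j) j = lp_J p x j + lp_J p y j"
    using assms[of j] by (auto simp: lp_J_def)
qed

lemma pairing_tail: "pairing (tail n x) y = pairing x (tail n y)"
  unfolding pairing_def tail_def by (intro arg_cong[where f = suminf]) auto

lemma tail_eq_self: "(\<And>j. j < n \<Longrightarrow> x j = 0) \<Longrightarrow> tail n x = x"
  by (auto simp: tail_def)

lemma norm_pairing_commute: "norm (pairing x y) = norm (pairing y x)" if "summable (\<lambda>j. x j * cnj (y j))"
proof -
  have "(\<lambda>j. cnj (x j * cnj (y j))) sums cnj (pairing x y)"
    unfolding pairing_def sums_cnj by (rule summable_sums[OF that])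
  then have "pairing y x = cnj (pairing x y)"
    by (simp add: pairing_def[of y] sums_iff mult.commute)
  then show ?thesis by simp
qed

abbreviation lp_form :: "real \<Rightarrow> ((nat \<Rightarrow> complex) \<Rightarrow> nat \<Rightarrow> complex) \<Rightarrow> (nat \<Rightarrow> complex) \<Rightarrow> complex" where
  "lp_form p T x \<equiv> pairing (T x) (lp_J p x)"

locale conjugate_exponents =
  fixes p q :: real
  assumes p: "1 < p" and pq: "1 / p + 1 / q = 1"
begin

lemma q: "1 < q"
proof -
  have "1 / q = 1 - 1 / p" using pq by simp
  moreover have "0 < 1 / p" "1 / p < 1" using p by auto
  ultimately have "0 < 1 / q" "1 / q < 1" by auto
  then show ?thesis by (auto simp: divide_less_eq split: if_splits)
qed

lemma pos [simp]: "0 < p" "0 < q" "1 \<le> p" "1 \<le> q"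
  using p q by auto

lemma p_minus_1_times_q: "(p - 1) * q = p"
  using pq p q by (simp add: field_simps)

text \<open>
  Young's inequality, applied in each coordinate to the normalised sequences \<open>x / \<parallel>x\<parallel>\<close> and
  \<open>y / \<parallel>y\<parallel>\<close>, sums up to \<open>1 / p + 1 / q = 1\<close>.
\<close>

lemma Hoelder:
  assumes x: "x \<in> lp p" and y: "y \<in> lp q"
  shows "summable (\<lambda>j. norm (x j * cnj (y j)))"
    and "norm (pairing x y) \<le> lp_norm p x * lp_norm q y"
proof -
  let ?A = "lp_norm p x" and ?B = "lp_norm q y"
  have "summable (\<lambda>j. norm (x j * cnj (y j))) \<and> norm (pairing x y) \<le> ?A * ?B"
  proof (cases "?A = 0 \<or> ?B = 0")
    case True
    then have "x = (\<lambda>j. 0) \<or> y = (\<lambda>j. 0)"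
      using lp_norm_eq_0_iff[OF _ x] lp_norm_eq_0_iff[OF _ y] by simp
    then show ?thesis
      by (auto simp: pairing_def)
  next
    case False
    then have AB: "?A > 0" "?B > 0"
      using lp_norm_nonneg by (metis order_le_less)+
    let ?g = "\<lambda>j. ?A * ?B * (norm (x j) powr p / ?A powr p / p + norm (y j) powr q / ?B powr q / q)"
    have le: "norm (x j * cnj (y j)) \<le> ?g j" for j
    proof -
      have "norm (x j) / ?A * (norm (y j) / ?B) \<le>
          (norm (x j) / ?A) powr p / p + (norm (y j) / ?B) powr q / q"
        by (rule Youngs_inequality) (use p q pq in auto)
      from mult_left_mono[OF this, of "?A * ?B"] show ?thesis
        using AB by (simp add: norm_mult powr_divide field_simps)
    qed
    have "?g sums (?A * ?B * (?A powr p / ?A powr p / p + ?B powr q / ?B powr q / q))"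
      using x y by (intro sums_mult sums_add sums_divide)
        (auto simp: lp_norm_powr lp_def summable_sums)
    then have g: "?g sums (?A * ?B)"
      using AB pq by simp
    have s: "summable (\<lambda>j. norm (x j * cnj (y j)))"
      by (rule summable_comparison_test'[OF sums_summable[OF g], of 0]) (use le in simp)
    have "norm (pairing x y) \<le> (\<Sum>j. norm (x j * cnj (y j)))"
      unfolding pairing_def by (rule summable_norm[OF s])
    also have "\<dots> \<le> ?A * ?B"
      using suminf_le[OF le s sums_summable[OF g]] g by (simp add: sums_iff)
    finally show ?thesis
      using s by blast
  qed
  then show "summable (\<lambda>j. norm (x j * cnj (y j)))" "norm (pairing x y) \<le> ?A * ?B"
    by auto
qed

lemma pairing_sums:
  assumes "x \<in> lp p" "y \<in> lp q"
  shows "(\<lambda>j. x j * cnj (y j)) sums pairing x y"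
  unfolding pairing_def
  by (rule summable_sums[OF summable_norm_cancel[OF Hoelder(1)[OF assms]]])

lemma pairing_add_left:
  assumes "x \<in> lp p" "x' \<in> lp p" "y \<in> lp q"
  shows "pairing (\<lambda>j. x j + x' j) y = pairing x y + pairing x' y"
  using sums_add[OF pairing_sums[OF assms(1,3)] pairing_sums[OF assms(2,3)]]
  by (simp add: pairing_def[of "\<lambda>j. x j + x' j"] sums_iff algebra_simps)

lemma pairing_add_right:
  assumes "x \<in> lp p" "y \<in> lp q" "y' \<in> lp q"
  shows "pairing x (\<lambda>j. y j + y' j) = pairing x y + pairing x y'"
  using sums_add[OF pairing_sums[OF assms(1,2)] pairing_sums[OF assms(1,3)]]
  by (simp add: pairing_def[of _ "\<lambda>j. y j + y' j"] sums_iff algebra_simps)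

lemma pairing_scale_left:
  assumes "x \<in> lp p" "y \<in> lp q"
  shows "pairing (\<lambda>j. c * x j) y = c * pairing x y"
  using sums_mult[OF pairing_sums[OF assms], of c]
  by (simp add: pairing_def[of "\<lambda>j. c * x j"] sums_iff algebra_simps)

lemma pairing_scale_right:
  assumes "x \<in> lp p" "y \<in> lp q"
  shows "pairing x (\<lambda>j. c * y j) = cnj c * pairing x y"
  using sums_mult[OF pairing_sums[OF assms], of "cnj c"]
  by (simp add: pairing_def[of _ "\<lambda>j. c * y j"] sums_iff algebra_simps)

text \<open>
  The exponents match because \<open>(p - 1) q = p\<close>; in particular \<open>J\<close> maps unit vectors to unit vectors.
\<close>

lemma lp_J_lp:
  assumes x: "x \<in> lp p"
  shows "lp_J p x \<in> lp q" and "lp_norm q (lp_J p x) = lp_norm p x powr (p - 1)"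
proof -
  have "(\<lambda>j. norm (lp_J p x j) powr q) sums ((lp_norm p x powr (p - 1)) powr q)"
    using x unfolding norm_lp_J powr_powr p_minus_1_times_q
    by (simp add: lp_norm_powr lp_def summable_sums)
  from lp_norm_eqI[OF _ _ this]
  show "lp_J p x \<in> lp q" "lp_norm q (lp_J p x) = lp_norm p x powr (p - 1)"
    by auto
qed

lemma pairing_lp_J:
  assumes x: "x \<in> lp p"
  shows "pairing x (lp_J p x) = of_real (lp_norm p x powr p)"
  using x by (simp add: pairing_def mult_cnj_lp_J lp_norm_powr lp_def suminf_of_real)

end

text \<open>
  The pairing is used with each of its arguments in the role of the fixed one, so its
  properties are needed for both orders of the exponents.
\<close>

sublocale conjugate_exponents \<subseteq> dual: conjugate_exponents q p
  by unfold_locales (use q pq in \<open>auto simp: add.commute\<close>)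

section \<open>Weakly null sequences and compact operators\<close>

context conjugate_exponents
begin

text \<open>
  Against a vector supported beyond \<open>n\<close> only the tail of \<open>y\<close> matters, and the tails of \<open>y\<close> tend to
  \<open>0\<close> in norm.
\<close>

lemma pairing_tails_tendsto_0:
  assumes y: "y \<in> lp q" and x: "\<And>n. x n \<in> lp p" "\<And>n. lp_norm p (x n) \<le> 1"
    and tail: "\<And>n j. j < n \<Longrightarrow> x n j = 0"
  shows "(\<lambda>n. pairing (x n) y) \<longlonglongrightarrow> 0"
proof (rule Lim_null_comparison)
  show "(\<lambda>n. lp_norm q (tail n y)) \<longlonglongrightarrow> 0"
    by (rule lp_norm_tail_tendsto_0) (use y in auto)
  have "norm (pairing (x n) y) \<le> lp_norm q (tail n y)" for n
  proof -
    have "pairing (x n) y = pairing (x n) (tail n y)"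
      using pairing_tail[of n "x n" y] tail by (simp add: tail_eq_self)
    also have "norm \<dots> \<le> lp_norm p (x n) * lp_norm q (tail n y)"
      by (intro Hoelder x tail_lp y) auto
    also have "\<dots> \<le> lp_norm q (tail n y)"
      using x by (intro mult_left_le_one_le) auto
    finally show ?thesis .
  qed
  then show "\<forall>\<^sub>F n in sequentially. norm (pairing (x n) y) \<le> lp_norm q (tail n y)"
    by simp
qed

lemma lp_weakly_null_iff: "lp_weakly_null p x \<longleftrightarrow> (\<forall>y\<in>lp q. (\<lambda>n. pairing (x n) y) \<longlonglongrightarrow> 0)"
proof -
  have "1 / p + 1 / r = 1 \<longleftrightarrow> r = q" for r
  proof
    assume "1 / p + 1 / r = 1"
    then have "1 / r = 1 / q"
      using pq by linarith
    then show "r = q"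
      by (simp add: divide_inverse)
  qed (use pq in simp)
  then show ?thesis
    by (simp add: lp_weakly_null_def)
qed

lemma tails_weakly_null:
  assumes "\<And>n. x n \<in> lp p" "\<And>n. lp_norm p (x n) \<le> 1" "\<And>n j. j < n \<Longrightarrow> x n j = 0"
  shows "lp_weakly_null p x"
  unfolding lp_weakly_null_iff by (intro ballI pairing_tails_tendsto_0 assms)

text \<open>
  The Riesz representation \<open>(\<ell>\<^sub>p)\<^sup>* = \<ell>\<^sub>q\<close>. The coefficients \<open>g\<close> can only be the conjugated values of
  \<open>f\<close> on the unit vectors. They form an \<open>\<ell>\<^sub>q\<close> sequence because testing \<open>f\<close> on the vector
  \<open>J\<^sub>q (P\<^sub>n g)\<close>, for which Hoelder's inequality is an equality, bounds \<open>\<parallel>P\<^sub>n g\<parallel>\<close> by the norm of \<open>f\<close>.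
\<close>

lemma lp_functional_representation:
  assumes f: "f \<in> lp_functionals p"
  obtains g where "g \<in> lp q" "\<And>x. x \<in> lp p \<Longrightarrow> f x = pairing x g"
proof -
  obtain C where C: "\<And>x. x \<in> lp p \<Longrightarrow> norm (f x) \<le> C * lp_norm p x"
    using f unfolding lp_functionals_def by blast
  define g where "g j = cnj (f (basis j))" for j
  have f_head: "f (head n x) = (\<Sum>j<n. x j * cnj (g j))" for n x
    using lp_functional_head[OF pos(1) f] by (simp add: g_def)
  have bound: "(\<Sum>j<n. norm (g j) powr q) \<le> \<bar>C\<bar> powr q" for n
  proof -
    let ?h = "head n g"
    let ?s = "lp_norm q ?h"
    have h: "?h \<in> lp q" by simp
    have sum: "(\<Sum>j<n. norm (g j) powr q) = ?s powr q"
    proof -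
      have "(\<lambda>j. norm (?h j) powr q) = (\<lambda>j. if j \<in> {..<n} then norm (g j) powr q else 0)"
        by (auto simp: head_def)
      moreover have "(\<lambda>j. if j \<in> {..<n} then norm (g j) powr q else 0) sums (\<Sum>j<n. norm (g j) powr q)"
        by (rule sums_If_finite_set) simp
      ultimately show ?thesis
        using h by (simp add: lp_norm_powr sums_iff)
    qed
    have J: "lp_J q ?h = head n (lp_J q g)"
      by (auto simp: lp_J_def head_def)
    have "f (lp_J q ?h) = (\<Sum>j<n. lp_J q g j * cnj (g j))"
      unfolding J by (rule f_head)
    also have "\<dots> = (\<Sum>j<n. of_real (norm (g j) powr q))"
    proof (rule sum.cong[OF refl])
      fix j
      show "lp_J q g j * cnj (g j) = of_real (norm (g j) powr q)"
        using arg_cong[OF mult_cnj_lp_J[of g j q], of cnj] by (simp add: mult.commute)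
    qed
    also have "\<dots> = of_real (?s powr q)"
      using sum by (simp flip: of_real_sum)
    finally have "?s powr q \<le> C * lp_norm p (lp_J q ?h)"
      using C[OF dual.lp_J_lp(1)[OF h]] by simp
    also have "\<dots> = C * ?s powr (q - 1)"
      using dual.lp_J_lp(2)[OF h] by simp
    also have "\<dots> \<le> \<bar>C\<bar> * ?s powr (q - 1)"
      by (intro mult_right_mono) auto
    finally have le: "?s powr q \<le> \<bar>C\<bar> * ?s powr (q - 1)" .
    have "?s \<le> \<bar>C\<bar>"
    proof (cases "?s = 0")
      case False
      then have s: "?s > 0"
        using lp_norm_nonneg by (metis order_le_less)
      then have "?s * ?s powr (q - 1) = ?s powr q"
        using powr_add[of ?s 1 "q - 1"] by simp
      then have "?s * ?s powr (q - 1) \<le> \<bar>C\<bar> * ?s powr (q - 1)"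
        using le by simp
      then show ?thesis
        using s by simp
    qed simp
    then show ?thesis
      unfolding sum by (intro powr_mono2) (use q in auto)
  qed
  have g: "g \<in> lp q"
    unfolding lp_def mem_Collect_eq
    by (rule bounded_imp_summable[where B = "\<bar>C\<bar> powr q"])
      (use bound in \<open>simp_all only: powr_ge_zero flip: lessThan_Suc_atMost\<close>)
  have "f x = pairing x g" if x: "x \<in> lp p" for x
  proof (rule LIMSEQ_unique)
    show "(\<lambda>n. f (head n x)) \<longlonglongrightarrow> pairing x g"
      using pairing_sums[OF x g] by (simp add: f_head sums_def)
    have "(\<lambda>n. f x - f (head n x)) \<longlonglongrightarrow> 0"
    proof (rule Lim_null_comparison)
      show "(\<lambda>n. C * lp_norm p (tail n x)) \<longlonglongrightarrow> 0"
        using tendsto_mult[OF tendsto_const lp_norm_tail_tendsto_0[OF _ x], of C] by simp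
      have "f x - f (head n x) = f (tail n x)" for n
      proof -
        have "f (\<lambda>j. head n x j + tail n x j) = f (head n x) + f (tail n x)"
          by (rule lp_functionalsD(1)[OF f]) (use x in auto)
        then show ?thesis
          by (simp only: head_plus_tail) simp
      qed
      then show "\<forall>\<^sub>F n in sequentially. norm (f x - f (head n x)) \<le> C * lp_norm p (tail n x)"
        using C[OF tail_lp[OF pos(1) x]] by (auto intro!: always_eventually)
    qed
    from tendsto_diff[OF tendsto_const[of "f x"] this]
    show "(\<lambda>n. f (head n x)) \<longlonglongrightarrow> f x"
      by simp
  qed
  with g show ?thesis
    using that by blast
qed

lemma weakly_null_functional:
  assumes "f \<in> lp_functionals p" "lp_weakly_null p x" "\<And>n. x n \<in> lp p"
  shows "(\<lambda>n. f (x n)) \<longlonglongrightarrow> 0"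
proof -
  obtain g where g: "g \<in> lp q" "\<And>x. x \<in> lp p \<Longrightarrow> f x = pairing x g"
    using lp_functional_representation[OF assms(1)] by blast
  then show ?thesis
    using assms by (simp add: lp_weakly_null_iff)
qed

text \<open>
  Each coordinate of \<open>K x\<close> is a bounded functional of \<open>x\<close>, so the images \<open>K (x n)\<close> tend to \<open>0\<close>
  coordinatewise. Hence \<open>0\<close> is the only possible limit of a norm convergent subsequence, and
  compactness provides such a subsequence inside any subsequence that stays away from \<open>0\<close>.
\<close>

lemma compact_operator_weakly_null:
  assumes K: "K \<in> lp_compact_operators p" and null: "lp_weakly_null p x"
    and x: "\<And>n. x n \<in> lp p" "\<And>n. lp_norm p (x n) \<le> 1"
  shows "(\<lambda>n. lp_norm p (K (x n))) \<longlonglongrightarrow> 0"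
proof (rule ccontr)
  note K' = K[unfolded lp_compact_operators_iff[OF pos(3)]]
  note Kop = K'[THEN conjunct1]
  assume "\<not> ?thesis"
  then obtain e where e: "e > 0" "\<And>N. \<exists>n\<ge>N. e \<le> lp_norm p (K (x n))"
    by (auto simp: LIMSEQ_def not_less)
  then have "infinite {n. e \<le> lp_norm p (K (x n))}"
    by (auto simp: infinite_nat_iff_unbounded_le)
  then obtain r :: "nat \<Rightarrow> nat" where r: "strict_mono r" "\<And>n. e \<le> lp_norm p (K (x (r n)))"
    using infinite_enumerate by blast
  obtain l s where l: "l \<in> lp p" and s: "strict_mono s"
    and lim: "(\<lambda>n. lp_norm p (\<lambda>j. K (x (r (s n))) j - l j)) \<longlonglongrightarrow> 0"
    using K'[THEN conjunct2, rule_format, of "\<lambda>n. x (r n)"] x by blast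
  have Kx: "K (x n) \<in> lp p" for n
    using lp_operatorsD(1)[OF Kop] x by blast
  have "l j = 0" for j
  proof (rule LIMSEQ_unique)
    show "(\<lambda>n. K (x (r (s n))) j) \<longlonglongrightarrow> 0"
      using LIMSEQ_subseq_LIMSEQ[OF weakly_null_functional[OF lp_functional_coordinate[OF pos(1) Kop] null x(1)]
          strict_mono_o[OF r(1) s]] by (simp add: o_def)
    have "(\<lambda>n. K (x (r (s n))) j - l j) \<longlonglongrightarrow> 0"
    proof (rule Lim_null_comparison[OF _ lim])
      show "\<forall>\<^sub>F n in sequentially. norm (K (x (r (s n))) j - l j) \<le>
          lp_norm p (\<lambda>j. K (x (r (s n))) j - l j)"
        using norm_le_lp_norm[OF pos(1) lp_diff[OF pos(3) Kx l]] by auto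
    qed
    then show "(\<lambda>n. K (x (r (s n))) j) \<longlonglongrightarrow> l j"
      by (simp add: LIM_zero_iff)
  qed
  then have "(\<lambda>n. lp_norm p (K (x (r (s n))))) \<longlonglongrightarrow> 0"
    using lim by simp
  then have "e \<le> 0"
    by (rule LIMSEQ_le_const) (intro exI[of _ 0] allI impI r(2))
  then show False
    using e(1) by simp
qed

end

section \<open>The numerical form on tails\<close>

context conjugate_exponents
begin

lemma norm_pairing_operator_le:
  assumes T: "T \<in> lp_operators p" and C: "\<And>x. x \<in> lp p \<Longrightarrow> lp_norm p (T x) \<le> C * lp_norm p x"
    and x: "x \<in> lp p" and y: "y \<in> lp p"
  shows "norm (pairing (T x) (lp_J p y)) \<le> C * lp_norm p x * lp_norm p y powr (p - 1)"
proof -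
  have "norm (pairing (T x) (lp_J p y)) \<le> lp_norm p (T x) * lp_norm q (lp_J p y)"
    using Hoelder(2)[OF lp_operatorsD(1)[OF T x] lp_J_lp(1)[OF y]] .
  also have "\<dots> \<le> C * lp_norm p x * lp_norm p y powr (p - 1)"
    unfolding lp_J_lp(2)[OF y] by (intro mult_right_mono C x) auto
  finally show ?thesis .
qed

lemma pairing_operator_scale:
  assumes T: "T \<in> lp_operators p" and x: "x \<in> lp p" and y: "y \<in> lp p" and b: "b \<ge> 0"
  shows "pairing (T (\<lambda>j. of_real a * x j)) (lp_J p (\<lambda>j. of_real b * y j)) =
    of_real (a * b powr (p - 1)) * pairing (T x) (lp_J p y)"
proof -
  note Tx = lp_operatorsD(1)[OF T x] and J = lp_J_lp(1)[OF y]
  show ?thesis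
    unfolding lp_operatorsD(3)[OF T x] lp_J_scale[OF b]
    using Tx J by (simp add: pairing_scale_left pairing_scale_right lp_scale)
qed

lemma lp_form_scale:
  assumes T: "T \<in> lp_operators p" and x: "x \<in> lp p" and a: "a \<ge> 0"
  shows "lp_form p T (\<lambda>j. of_real a * x j) = of_real (a powr p) * lp_form p T x"
proof -
  have "a * a powr (p - 1) = a powr p"
    using a powr_add[of a 1 "p - 1"] by (cases "a = 0") auto
  then show ?thesis
    using pairing_operator_scale[OF T x x a, of a] by simp
qed

lemma lp_form_disjoint_add:
  assumes T: "T \<in> lp_operators p" and x: "x \<in> lp p" and y: "y \<in> lp p"
    and disj: "\<And>j. x j = 0 \<or> y j = 0"
  shows "lp_form p T (\<lambda>j. x j + y j) = lp_form p T x + lp_form p T y +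
    pairing (T x) (lp_J p y) + pairing (T y) (lp_J p x)"
  unfolding lp_operatorsD(2)[OF T x y] lp_J_disjoint_add[OF disj]
  using lp_operatorsD(1)[OF T] lp_J_lp(1) x y
  by (simp add: pairing_add_left pairing_add_right lp_add)

text \<open>
  The compact perturbation is chosen so that \<open>T + K = Q\<^sub>n T Q\<^sub>n + c P\<^sub>n\<close>. This decouples the first \<open>n\<close>
  coordinates from the others, and on the former the value of the form is known: it is
  \<open>c \<parallel>P\<^sub>n x\<parallel>\<^sup>p\<close>.
\<close>

lemma num_range_compression:
  assumes T: "T \<in> lp_operators p"
    and l: "l \<in> (\<Inter>K\<in>lp_compact_operators p. closure (num_range p (\<lambda>x j. T x j + K x j)))"
    and e: "e > 0"
  obtains x where "x \<in> lp p" "lp_norm p x = 1"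
    "norm (lp_form p T (tail n x) + of_real (1 - lp_norm p (tail n x) powr p) * c - l) < e"
proof -
  note Tlp = lp_operatorsD(1)[OF T]
  \<comment> \<open>As Q T Q = T - P T - T P + P T P, the perturbation is K = P (c - T + T P) - T P, where P and Q
    stand for the projections head n and tail n. Both summands have finite rank.\<close>
  let ?S = "\<lambda>x j. (c * x j + (-1) * T x j) + T (head n x) j"
  let ?K = "\<lambda>x j. head n (?S x) j + (-1) * T (head n x) j"
  have "?K \<in> lp_compact_operators p"
    by (intro lp_compact_operators_add lp_compact_operators_head_left lp_operators_add
        lp_operators_scale lp_operators_id lp_operators_head_right T
        lp_compact_operators_head_right[of p "\<lambda>x j. (-1) * T x j"] p) auto
  then have "l \<in> closure (num_range p (\<lambda>x j. T x j + ?K x j))"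
    using l by blast
  then obtain w where "w \<in> num_range p (\<lambda>x j. T x j + ?K x j)" "dist w l < e"
    using e unfolding closure_approachable by blast
  then obtain x where x: "x \<in> lp p" "lp_norm p x = 1"
      and w: "norm (pairing (\<lambda>j. T x j + ?K x j) (lp_J p x) - l) < e"
    by (auto simp: num_range_def dist_norm)
  have ht: "head n x \<in> lp p" "tail n x \<in> lp p"
    using x by auto
  have "T x = (\<lambda>j. T (head n x) j + T (tail n x) j)"
    using lp_operatorsD(2)[OF T ht] by (simp add: head_plus_tail)
  then have "(\<lambda>j. T x j + ?K x j) = (\<lambda>j. tail n (T (tail n x)) j + c * head n x j)"
    by (auto simp: head_def tail_def fun_eq_iff)
  then have "pairing (\<lambda>j. T x j + ?K x j) (lp_J p x) =
      pairing (tail n (T (tail n x))) (lp_J p x) + c * pairing (head n x) (lp_J p x)"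
    using ht x Tlp lp_J_lp(1) by (simp add: pairing_add_left pairing_scale_left lp_scale)
  also have "pairing (tail n (T (tail n x))) (lp_J p x) = lp_form p T (tail n x)"
    unfolding pairing_tail by (intro arg_cong[where f = "pairing _"]) (auto simp: lp_J_def tail_def)
  also have "pairing (head n x) (lp_J p x) = pairing (head n x) (lp_J p (head n x))"
    unfolding pairing_def by (intro arg_cong[where f = suminf]) (auto simp: lp_J_def head_def)
  also have "\<dots> = of_real (lp_norm p (head n x) powr p)"
    by (rule pairing_lp_J[OF ht(1)])
  also have "lp_norm p (head n x) powr p = 1 - lp_norm p (tail n x) powr p"
    using lp_norm_head_tail[OF pos(1) x(1), of n] x by simp
  finally show ?thesis
    using w x by (intro that[of x]) (simp_all add: mult.commute)
qed

text \<open>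
  Apply the preceding lemma with \<open>c = l + d\<close>: for a unit vector \<open>x\<close> and \<open>t = \<parallel>Q\<^sub>n x\<parallel>\<^sup>p\<close> it makes
  \<open>t (w - l) + (1 - t) d\<close> small, where \<open>w\<close> is the value of the form at the normalised tail of \<open>x\<close>.
  Dividing by \<open>t\<close> places \<open>w\<close> near \<open>l - r d\<close> with \<open>r = (1 - t) / t\<close>. The division is harmless because
  \<open>t\<close> is bounded below in terms of \<open>l\<close> and the norm of \<open>T\<close>: for small \<open>t\<close> the expression would have
  absolute value close to \<open>\<bar>d\<bar> = 1\<close>.
\<close>

lemma tail_form_on_ray:
  assumes T: "T \<in> lp_operators p"
    and l: "l \<in> (\<Inter>K\<in>lp_compact_operators p. closure (num_range p (\<lambda>x j. T x j + K x j)))"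
    and e: "e > 0" and d: "norm d = 1"
  obtains v r where "v \<in> lp p" "lp_norm p v = 1" "\<And>j. j < n \<Longrightarrow> v j = 0" "r \<ge> 0"
    "norm (lp_form p T v - (l - of_real r * d)) < e"
proof -
  obtain C where C: "C > 0" "\<And>x. x \<in> lp p \<Longrightarrow> lp_norm p (T x) \<le> C * lp_norm p x"
    using lp_operators_bound[OF T] by blast
  \<comment> \<open>1 / (2 M) is the lower bound for t; the tolerance \<epsilon> is chosen so that \<epsilon> / t stays below e.\<close>
  define M where "M = 1 + C + norm l"
  have M: "M > 0"
    using C by (simp add: M_def add_pos_nonneg)
  define \<epsilon> where "\<epsilon> = min (1/2) (e / (2 * M))"
  have \<epsilon>: "\<epsilon> > 0" "\<epsilon> \<le> 1/2" "\<epsilon> * (2 * M) \<le> e"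
    using e M by (auto simp: \<epsilon>_def min_def field_simps)
  obtain x where x: "x \<in> lp p" "lp_norm p x = 1"
    and near: "norm (lp_form p T (tail n x) + of_real (1 - lp_norm p (tail n x) powr p) * (l + d) - l) < \<epsilon>"
    using num_range_compression[OF T l \<epsilon>(1)] by blast
  define s where "s = lp_norm p (tail n x)"
  define t where "t = s powr p"
  define A where "A = lp_form p T (tail n x)"
  have tx: "tail n x \<in> lp p"
    using x by simp
  have s: "s \<ge> 0" "s \<le> 1"
    using lp_norm_tail_le[OF pos(1) x(1), of n] x by (auto simp: s_def)
  have t: "t \<ge> 0" "t \<le> 1"
    using s powr_mono2[of p s 1] p by (auto simp: t_def)
  have "s * s powr (p - 1) = t"
    using s powr_add[of s 1 "p - 1"] by (cases "s = 0") (auto simp: t_def)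
  then have A: "norm A \<le> C * t"
    using norm_pairing_operator_le[OF T C(2) tx tx] by (simp add: A_def s_def mult.assoc)
  have eq: "A + of_real (1 - t) * (l + d) - l = (A - of_real t * l) + of_real (1 - t) * d"
    by (simp add: algebra_simps)
  have near': "norm ((A - of_real t * l) + of_real (1 - t) * d) < \<epsilon>"
    using near unfolding eq[symmetric] by (simp add: A_def t_def s_def)
  have "1 - t = norm (of_real (1 - t) * d)"
    using t d by (simp add: norm_mult del: of_real_diff)
  also have "\<dots> \<le> norm ((A - of_real t * l) + of_real (1 - t) * d) + norm (A - of_real t * l)"
    by (metis add_diff_cancel_left' norm_triangle_ineq4)
  also have "\<dots> \<le> \<epsilon> + (C * t + t * norm l)"
    using near' A t norm_triangle_ineq4[of A "of_real t * l"] by (simp add: norm_mult)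
  finally have tM: "1/2 \<le> t * M"
    using \<epsilon> by (simp add: M_def algebra_simps)
  then have t0: "t > 0"
    using M t by (cases "t = 0") auto
  then have s0: "s > 0"
    using s by (cases "s = 0") (auto simp: t_def)
  define v where "v = (\<lambda>j. of_real (1 / s) * tail n x j)"
  define r where "r = (1 - t) / t"
  show ?thesis
  proof (rule that)
    show "v \<in> lp p" "lp_norm p v = 1"
      using lp_scale[OF pos(1) tx, of "of_real (1 / s)"] s0
      unfolding v_def by (auto simp: norm_divide s_def)
    show "v j = 0" if "j < n" for j
      using that by (simp add: v_def tail_def)
    show "r \<ge> 0"
      using t by (simp add: r_def)
    have "lp_form p T v = of_real ((1 / s) powr p) * A"
      using lp_form_scale[OF T tx, of "1 / s"] s0 by (simp add: v_def A_def)
    also have "(1 / s) powr p = 1 / t"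
      using s0 by (simp add: t_def powr_divide)
    finally have "lp_form p T v - (l - of_real r * d) =
        ((A - of_real t * l) + of_real (1 - t) * d) / of_real t"
      using t0 by (simp add: r_def field_simps)
    then have "norm (lp_form p T v - (l - of_real r * d)) =
        norm ((A - of_real t * l) + of_real (1 - t) * d) / t"
      using t0 by (simp add: norm_divide)
    also have "\<dots> < \<epsilon> / t"
      using near' t0 by (simp add: divide_strict_right_mono)
    also have "\<dots> \<le> e"
    proof -
      have "\<epsilon> * 1 \<le> \<epsilon> * (2 * (t * M))"
        using \<epsilon> tM by (intro mult_left_mono) auto
      also have "\<dots> \<le> e * t"
        using mult_right_mono[OF \<epsilon>(3), of t] t by (simp add: mult_ac)
      finally show ?thesis
        using t0 by (simp add: field_simps)
    qed
    finally show "norm (lp_form p T v - (l - of_real r * d)) < e" .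
  qed
qed

text \<open>
  The form is continuous along the truncations of \<open>x\<close>. Splitting \<open>x\<close> into head and tail, all terms
  other than the form of the head are bounded by a multiple of the norm of the tail or of its
  \<open>(p - 1)\<close>-st power, so no continuity of \<open>J\<close> is involved.
\<close>

lemma lp_form_head_tendsto:
  assumes T: "T \<in> lp_operators p" and x: "x \<in> lp p"
  shows "(\<lambda>m. lp_form p T (head m x)) \<longlonglongrightarrow> lp_form p T x"
proof -
  obtain C where C: "C > 0" "\<And>x. x \<in> lp p \<Longrightarrow> lp_norm p (T x) \<le> C * lp_norm p x"
    using lp_operators_bound[OF T] by blast
  let ?N = "lp_norm p x" and ?s = "\<lambda>m. lp_norm p (tail m x)"
  let ?b = "\<lambda>m. C * ?s m * ?s m powr (p - 1) + C * ?N * ?s m powr (p - 1) + C * ?s m * ?N powr (p - 1)"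
  have s0: "?s \<longlonglongrightarrow> 0"
    by (rule lp_norm_tail_tendsto_0) (use x in auto)
  have "(\<lambda>m. ?s m powr (p - 1)) \<longlonglongrightarrow> 0 powr (p - 1)"
    using p by (intro tendsto_powr' s0 tendsto_const) auto
  then have "(\<lambda>m. ?s m powr (p - 1)) \<longlonglongrightarrow> 0"
    by simp
  note tendsto_add[OF tendsto_add[OF
      tendsto_mult[OF tendsto_mult_left[OF s0, of C] this] tendsto_mult_left[OF this, of "C * ?N"]]
      tendsto_mult_right[OF tendsto_mult_left[OF s0, of C], of "?N powr (p - 1)"]]
  then have b0: "?b \<longlonglongrightarrow> 0"
    by (simp only: mult_zero_right mult_zero_left add_0_right)
  have "norm (lp_form p T x - lp_form p T (head m x)) \<le> ?b m" for m
  proof -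
    have ht: "head m x \<in> lp p" "tail m x \<in> lp p"
      using x by auto
    have hN: "lp_norm p (head m x) \<le> ?N"
      by (rule lp_norm_head_le) (use x in auto)
    have split: "lp_form p T x = lp_form p T (head m x) + lp_form p T (tail m x) +
        pairing (T (head m x)) (lp_J p (tail m x)) + pairing (T (tail m x)) (lp_J p (head m x))"
      using lp_form_disjoint_add[OF T ht head_tail_disjoint] by (simp only: head_plus_tail)
    have 1: "norm (lp_form p T (tail m x)) \<le> C * ?s m * ?s m powr (p - 1)"
      by (rule norm_pairing_operator_le[OF T C(2) ht(2) ht(2)])
    have "norm (pairing (T (head m x)) (lp_J p (tail m x))) \<le> C * lp_norm p (head m x) * ?s m powr (p - 1)"
      by (rule norm_pairing_operator_le[OF T C(2) ht])
    also have "\<dots> \<le> C * ?N * ?s m powr (p - 1)"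
      using C hN by (intro mult_right_mono mult_left_mono) auto
    finally have 2: "norm (pairing (T (head m x)) (lp_J p (tail m x))) \<le> C * ?N * ?s m powr (p - 1)" .
    have "norm (pairing (T (tail m x)) (lp_J p (head m x))) \<le> C * ?s m * lp_norm p (head m x) powr (p - 1)"
      by (rule norm_pairing_operator_le[OF T C(2) ht(2) ht(1)])
    also have "\<dots> \<le> C * ?s m * ?N powr (p - 1)"
      using C hN p by (intro mult_left_mono powr_mono2) auto
    finally have 3: "norm (pairing (T (tail m x)) (lp_J p (head m x))) \<le> C * ?s m * ?N powr (p - 1)" .
    have "lp_form p T x - lp_form p T (head m x) = lp_form p T (tail m x) +
        pairing (T (head m x)) (lp_J p (tail m x)) + pairing (T (tail m x)) (lp_J p (head m x))"
      using split by simp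
    then show ?thesis
      using norm_triangle_mono[OF norm_triangle_mono[OF 1 2] 3] by simp
  qed
  then have "(\<lambda>m. lp_form p T x - lp_form p T (head m x)) \<longlonglongrightarrow> 0"
    by (intro Lim_null_comparison[OF _ b0] always_eventually allI)
  from tendsto_diff[OF tendsto_const[of "lp_form p T x"] this] show ?thesis
    by simp
qed

lemma finitely_supported_approximation:
  assumes T: "T \<in> lp_operators p" and x: "x \<in> lp p" "lp_norm p x = 1" and e: "e > 0"
  obtains m a where "lp_norm p (\<lambda>j. of_real a * head m x j) = 1"
    "norm (lp_form p T (\<lambda>j. of_real a * head m x j) - lp_form p T x) < e"
proof -
  let ?h = "\<lambda>m. lp_norm p (head m x)"
  have h: "head m x \<in> lp p" for m
    by simp
  have "?h m powr p = 1 - lp_norm p (tail m x) powr p" for m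
    using lp_norm_head_tail[OF pos(1) x(1), of m] x by simp
  moreover have "(\<lambda>m. 1 - lp_norm p (tail m x) powr p) \<longlonglongrightarrow> 1 - 0 powr p"
    by (intro tendsto_diff tendsto_powr' tendsto_const lp_norm_tail_tendsto_0 x) auto
  ultimately have h1: "(\<lambda>m. ?h m powr p) \<longlonglongrightarrow> 1"
    by simp
  then have ev: "\<forall>\<^sub>F m in sequentially. 0 < ?h m powr p"
    by (rule order_tendstoD) simp
  have "(\<lambda>m. lp_form p T (head m x) / of_real (?h m powr p)) \<longlonglongrightarrow> lp_form p T x / of_real 1"
    by (intro tendsto_divide lp_form_head_tendsto T x tendsto_of_real h1) simp
  then have "\<forall>\<^sub>F m in sequentially. dist (lp_form p T (head m x) / of_real (?h m powr p)) (lp_form p T x) < e"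
    using e by (auto dest: tendstoD)
  from eventually_happens'[OF _ eventually_conj[OF ev this]]
  obtain m where m: "0 < ?h m powr p"
      "dist (lp_form p T (head m x) / of_real (?h m powr p)) (lp_form p T x) < e"
    by auto
  have "?h m \<noteq> 0"
    using m(1) by auto
  then have hm: "?h m > 0"
    using lp_norm_nonneg[of p "head m x"] by linarith
  have "lp_norm p (\<lambda>j. of_real (1 / ?h m) * head m x j) = 1"
    using lp_scale(2)[OF pos(1) h, of "of_real (1 / ?h m)"] hm by (simp add: norm_divide)
  moreover have "lp_form p T (\<lambda>j. of_real (1 / ?h m) * head m x j) =
      lp_form p T (head m x) / of_real (?h m powr p)"
    using lp_form_scale[OF T h, of "1 / ?h m" m] hm by (simp add: powr_divide)
  ultimately show ?thesis
    using m by (intro that[of "1 / ?h m" m]) (simp_all add: dist_norm)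
qed

text \<open>
  The weights are \<open>a\<^sup>p = \<alpha>\<close> and \<open>b\<^sup>p = 1 - \<alpha>\<close>. One cross term tends to \<open>0\<close> because \<open>T x\<close> is a fixed
  element of \<open>\<ell>\<^sub>p\<close> paired with the vectors \<open>J (y k)\<close>, which move off to infinity; the other one because
  \<open>\<langle>T z, J x\<rangle>\<close> is a bounded functional of \<open>z\<close> and \<open>y\<close> is weakly null. Their coefficients are at most
  \<open>1\<close>, so one index \<open>k\<close> works for all \<open>\<alpha>\<close>. This uniformity is needed where \<open>\<alpha>\<close> depends on \<open>k\<close>.
\<close>

lemma asymptotic_convexity:
  assumes T: "T \<in> lp_operators p"
    and x: "x \<in> lp p" "lp_norm p x = 1" "\<And>j. j \<ge> m \<Longrightarrow> x j = 0"
    and y: "\<And>k. y k \<in> lp p" "\<And>k. lp_norm p (y k) = 1" "\<And>k j. j < k \<Longrightarrow> y k j = 0"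
    and e: "e > 0"
  obtains k where "k \<ge> n" "\<And>\<alpha>. 0 \<le> \<alpha> \<Longrightarrow> \<alpha> \<le> 1 \<Longrightarrow> \<exists>a b.
    lp_norm p (\<lambda>j. of_real a * x j + of_real b * y k j) = 1 \<and>
    norm (lp_form p T (\<lambda>j. of_real a * x j + of_real b * y k j) -
      (of_real \<alpha> * lp_form p T x + of_real (1 - \<alpha>) * lp_form p T (y k))) < e"
proof -
  note Tx = lp_operatorsD(1)[OF T x(1)] and Jx = lp_J_lp(1)[OF x(1)]
  have "(\<lambda>k. pairing (lp_J p (y k)) (T x)) \<longlonglongrightarrow> 0"
  proof (rule dual.pairing_tails_tendsto_0[OF Tx])
    show "lp_J p (y k) j = 0" if "j < k" for k j
      using y(3)[OF that] by (simp add: lp_J_def)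
  qed (use y lp_J_lp in auto)
  then have c1: "(\<lambda>k. norm (pairing (T x) (lp_J p (y k)))) \<longlonglongrightarrow> 0"
    using norm_pairing_commute[OF sums_summable[OF pairing_sums[OF Tx lp_J_lp(1)[OF y(1)]]]]
    by (simp add: tendsto_norm_zero_iff)
  have "(\<lambda>z. pairing (T z) (lp_J p x)) \<in> lp_functionals p"
  proof -
    obtain C where C: "\<And>x. x \<in> lp p \<Longrightarrow> lp_norm p (T x) \<le> C * lp_norm p x"
      using lp_operators_bound[OF T] by blast
    have "norm (pairing (T z) (lp_J p x)) \<le> C * lp_norm p z" if "z \<in> lp p" for z
      using norm_pairing_operator_le[OF T C that x(1)] x(2) by simp
    then show ?thesis
      using lp_operatorsD[OF T] Jx
      by (auto simp: lp_functionals_def pairing_add_left pairing_scale_left)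
  qed
  moreover have "lp_weakly_null p y"
    by (rule tails_weakly_null) (use y in auto)
  ultimately have c2: "(\<lambda>k. norm (pairing (T (y k)) (lp_J p x))) \<longlonglongrightarrow> 0"
    by (intro tendsto_norm_zero weakly_null_functional[where f = "\<lambda>z. pairing (T z) (lp_J p x)"] y)
  have "(\<lambda>k. norm (pairing (T x) (lp_J p (y k))) + norm (pairing (T (y k)) (lp_J p x))) \<longlonglongrightarrow> 0"
    using tendsto_add[OF c1 c2] by simp
  then have "\<forall>\<^sub>F k in sequentially.
      norm (pairing (T x) (lp_J p (y k))) + norm (pairing (T (y k)) (lp_J p x)) < e"
    using e by (auto dest: order_tendstoD)
  from eventually_happens'[OF _ eventually_conj[OF this eventually_ge_at_top[of "max m n"]]]
  obtain k where k: "k \<ge> m" "k \<ge> n"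
      "norm (pairing (T x) (lp_J p (y k))) + norm (pairing (T (y k)) (lp_J p x)) < e"
    by auto
  show ?thesis
  proof (rule that[OF k(2)])
    fix \<alpha> :: real assume \<alpha>: "0 \<le> \<alpha>" "\<alpha> \<le> 1"
    define a where "a = \<alpha> powr (1 / p)"
    define b where "b = (1 - \<alpha>) powr (1 / p)"
    have ab: "a \<ge> 0" "b \<ge> 0" "a powr p = \<alpha>" "b powr p = 1 - \<alpha>"
      using \<alpha> p by (auto simp: a_def b_def powr_powr)
    have ab1: "a \<le> 1" "b \<le> 1"
      using \<alpha> p powr_mono2[of "1 / p" \<alpha> 1] powr_mono2[of "1 / p" "1 - \<alpha>" 1]
      by (auto simp: a_def b_def)
    have ab2: "a powr (p - 1) \<le> 1" "b powr (p - 1) \<le> 1"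
      using ab ab1 p powr_mono2[of "p - 1" a 1] powr_mono2[of "p - 1" b 1] by auto
    let ?x = "\<lambda>j. of_real a * x j" and ?y = "\<lambda>j. of_real b * y k j"
    have xy: "?x \<in> lp p" "?y \<in> lp p"
      using lp_scale(1)[OF pos(1)] x y by auto
    have disj: "?x j = 0 \<or> ?y j = 0" for j
      using x(3)[of j] y(3)[of j k] k(1) by (cases "j < k") auto
    have "lp_norm p (\<lambda>j. ?x j + ?y j) powr p = 1"
      using lp_norm_disjoint_add[OF pos(1) xy disj] lp_scale(2)[OF pos(1) x(1)]
        lp_scale(2)[OF pos(1) y(1)] x y ab by simp
    then have "(lp_norm p (\<lambda>j. ?x j + ?y j) powr p) powr (1 / p) = 1"
      by simp
    then have norm1: "lp_norm p (\<lambda>j. ?x j + ?y j) = 1"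
      using p by (simp add: powr_powr)
    have "lp_form p T (\<lambda>j. ?x j + ?y j) =
        of_real \<alpha> * lp_form p T x + of_real (1 - \<alpha>) * lp_form p T (y k) +
        of_real (a * b powr (p - 1)) * pairing (T x) (lp_J p (y k)) +
        of_real (b * a powr (p - 1)) * pairing (T (y k)) (lp_J p x)"
      unfolding lp_form_disjoint_add[OF T xy disj]
      by (simp only: lp_form_scale[OF T x(1) ab(1)] lp_form_scale[OF T y(1) ab(2)] ab(3,4)
          pairing_operator_scale[OF T x(1) y(1) ab(2)] pairing_operator_scale[OF T y(1) x(1) ab(1)])
    then have "norm (lp_form p T (\<lambda>j. ?x j + ?y j) -
        (of_real \<alpha> * lp_form p T x + of_real (1 - \<alpha>) * lp_form p T (y k))) =
        norm (of_real (a * b powr (p - 1)) * pairing (T x) (lp_J p (y k)) +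
        of_real (b * a powr (p - 1)) * pairing (T (y k)) (lp_J p x))"
      by simp
    also have "\<dots> \<le> norm (of_real (a * b powr (p - 1)) * pairing (T x) (lp_J p (y k))) +
        norm (of_real (b * a powr (p - 1)) * pairing (T (y k)) (lp_J p x))"
      by (rule norm_triangle_ineq)
    also have "\<dots> = a * b powr (p - 1) * norm (pairing (T x) (lp_J p (y k))) +
        b * a powr (p - 1) * norm (pairing (T (y k)) (lp_J p x))"
      using ab by (simp add: norm_mult)
    also have "\<dots> \<le> norm (pairing (T x) (lp_J p (y k))) + norm (pairing (T (y k)) (lp_J p x))"
      using ab ab1 ab2 by (intro add_mono mult_left_le_one_le mult_le_one) auto
    also have "\<dots> < e"
      by (rule k(3))
    finally show "\<exists>a b. lp_norm p (\<lambda>j. of_real a * x j + of_real b * y k j) = 1 \<and>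
        norm (lp_form p T (\<lambda>j. of_real a * x j + of_real b * y k j) -
          (of_real \<alpha> * lp_form p T x + of_real (1 - \<alpha>) * lp_form p T (y k))) < e"
      using norm1 by blast
  qed
qed

text \<open>
  The point \<open>l\<close> is reached as a convex combination of a value near \<open>l - r\<close> and one near \<open>l + s k\<close>. The
  first is attained at a vector whose support becomes finite by truncation; the second is available
  arbitrarily far out, so that asymptotic convexity applies to the pair.
\<close>

lemma tail_form_near_point:
  assumes T: "T \<in> lp_operators p"
    and l: "l \<in> (\<Inter>K\<in>lp_compact_operators p. closure (num_range p (\<lambda>x j. T x j + K x j)))"
    and e: "e > 0"
  obtains z where "z \<in> lp p" "lp_norm p z = 1" "\<And>j. j < n \<Longrightarrow> z j = 0"
    "norm (lp_form p T z - l) < e"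
proof -
  have e4: "e / 4 > 0"
    using e by simp
  obtain x r where x: "x \<in> lp p" "lp_norm p x = 1" "\<And>j. j < n \<Longrightarrow> x j = 0" and r: "r \<ge> 0"
      and xr: "norm (lp_form p T x - (l - of_real r)) < e / 4"
    using tail_form_on_ray[OF T l e4, of 1 n] by auto
  obtain m c where x'1: "lp_norm p (\<lambda>j. of_real c * head m x j) = 1"
      and x'x: "norm (lp_form p T (\<lambda>j. of_real c * head m x j) - lp_form p T x) < e / 4"
    using finitely_supported_approximation[OF T x(1,2) e4] by blast
  define x' where "x' = (\<lambda>j. of_real c * head m x j)"
  have x': "x' \<in> lp p" "lp_norm p x' = 1" "\<And>j. j \<ge> m \<Longrightarrow> x' j = 0" "\<And>j. j < n \<Longrightarrow> x' j = 0"
    using x x'1 lp_scale(1)[OF pos(1) head_lp[OF pos(1)]] by (auto simp: x'_def head_def)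
  have "\<exists>y s. y \<in> lp p \<and> lp_norm p y = 1 \<and> (\<forall>j<k. y j = 0) \<and> s \<ge> 0 \<and>
      norm (lp_form p T y - (l + of_real s)) < e / 4" for k
  proof -
    obtain v s where "v \<in> lp p" "lp_norm p v = 1" "\<And>j. j < k \<Longrightarrow> v j = 0" "s \<ge> 0"
        "norm (lp_form p T v - (l - of_real s * (-1))) < e / 4"
      using tail_form_on_ray[OF T l e4, of "-1" k] by (metis norm_minus_cancel norm_one)
    then show ?thesis
      by (intro exI[of _ v] exI[of _ s]) simp
  qed
  then obtain y s where y: "\<And>k. y k \<in> lp p" "\<And>k. lp_norm p (y k) = 1" "\<And>k j. j < k \<Longrightarrow> y k j = 0"
      and s: "\<And>k. s k \<ge> 0" and ys: "\<And>k. norm (lp_form p T (y k) - (l + of_real (s k))) < e / 4"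
    by metis
  obtain k where k: "k \<ge> n" and conv: "\<And>\<alpha>. 0 \<le> \<alpha> \<Longrightarrow> \<alpha> \<le> 1 \<Longrightarrow> \<exists>a b.
      lp_norm p (\<lambda>j. of_real a * x' j + of_real b * y k j) = 1 \<and>
      norm (lp_form p T (\<lambda>j. of_real a * x' j + of_real b * y k j) -
        (of_real \<alpha> * lp_form p T x' + of_real (1 - \<alpha>) * lp_form p T (y k))) < e / 4"
    using asymptotic_convexity[where m = m and n = n and y = y, OF T x'(1,2,3) y e4] by blast
  \<comment> \<open>The weight that solves \<alpha> (l - r) + (1 - \<alpha>) (l + s k) = l; if r = s k = 0, any weight does.\<close>
  define \<alpha> where "\<alpha> = (if r + s k = 0 then 1 else s k / (r + s k))"
  have \<alpha>: "0 \<le> \<alpha>" "\<alpha> \<le> 1"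
    using r s[of k] by (auto simp: \<alpha>_def divide_le_eq)
  have "\<alpha> * (r + s k) = s k"
    using r s[of k] by (auto simp: \<alpha>_def)
  then have "- \<alpha> * r + (1 - \<alpha>) * s k = 0"
    by (simp add: algebra_simps)
  then have "complex_of_real (- \<alpha> * r + (1 - \<alpha>) * s k) = 0"
    by simp
  then have l_eq: "l = of_real \<alpha> * (l - of_real r) + of_real (1 - \<alpha>) * (l + of_real (s k))"
    by (simp add: algebra_simps)
  obtain a b where z1: "lp_norm p (\<lambda>j. of_real a * x' j + of_real b * y k j) = 1"
    and z: "norm (lp_form p T (\<lambda>j. of_real a * x' j + of_real b * y k j) -
        (of_real \<alpha> * lp_form p T x' + of_real (1 - \<alpha>) * lp_form p T (y k))) < e / 4"
    using conv[OF \<alpha>] by blast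
  show ?thesis
  proof (rule that[OF _ z1])
    show "(\<lambda>j. of_real a * x' j + of_real b * y k j) \<in> lp p"
      using x' y by (intro lp_add lp_scale) auto
    show "of_real a * x' j + of_real b * y k j = 0" if "j < n" for j
      using that x'(4) y(3)[of j k] k by simp
    have x'r: "norm (lp_form p T x' - (l - of_real r)) \<le> e / 2"
      using norm_triangle_mono[OF less_imp_le[OF x'x] less_imp_le[OF xr]]
      by (simp add: x'_def algebra_simps)
    have "(of_real \<alpha> * lp_form p T x' + of_real (1 - \<alpha>) * lp_form p T (y k)) - l =
        of_real \<alpha> * (lp_form p T x' - (l - of_real r)) +
        of_real (1 - \<alpha>) * (lp_form p T (y k) - (l + of_real (s k)))"
      by (subst l_eq) (simp add: algebra_simps)
    also have "norm \<dots> \<le> \<alpha> * norm (lp_form p T x' - (l - of_real r)) +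
        (1 - \<alpha>) * norm (lp_form p T (y k) - (l + of_real (s k)))"
      using \<alpha> by (intro order_trans[OF norm_triangle_ineq]) (simp add: norm_mult del: of_real_diff)
    also have "\<dots> \<le> \<alpha> * (e / 2) + (1 - \<alpha>) * (e / 2)"
      using \<alpha> x'r ys[of k] e by (intro add_mono mult_left_mono) auto
    also have "\<dots> = e / 2"
      by (simp only: distrib_right[symmetric]) simp
    finally have "norm ((of_real \<alpha> * lp_form p T x' + of_real (1 - \<alpha>) * lp_form p T (y k)) - l) \<le> e / 2" .
    from norm_triangle_le[OF add_mono[OF less_imp_le[OF z] this]]
    show "norm (lp_form p T (\<lambda>j. of_real a * x' j + of_real b * y k j) - l) < e"
      using e by simp
  qed
qed

section \<open>The two inclusions\<close>

lemma ess_num_range_subset: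
  assumes T: "T \<in> lp_operators p" and K: "K \<in> lp_compact_operators p"
  shows "ess_num_range p T \<subseteq> closure (num_range p (\<lambda>x j. T x j + K x j))"
proof
  fix l assume "l \<in> ess_num_range p T"
  then obtain x where x: "\<And>n. x n \<in> lp p" "\<And>n. lp_norm p (x n) = 1"
      and null: "lp_weakly_null p x" and lim: "(\<lambda>n. lp_form p T (x n)) \<longlonglongrightarrow> l"
    unfolding ess_num_range_def by blast
  have Kop: "K \<in> lp_operators p"
    using K by (simp add: lp_compact_operators_def)
  note TK = lp_operatorsD(1)[OF T x(1)] lp_operatorsD(1)[OF Kop x(1)]
  have "(\<lambda>n. lp_norm p (K (x n))) \<longlonglongrightarrow> 0"
    by (rule compact_operator_weakly_null[OF K null]) (use x in auto)
  then have "(\<lambda>n. lp_form p K (x n)) \<longlonglongrightarrow> 0"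
  proof (rule Lim_null_comparison[rotated])
    show "\<forall>\<^sub>F n in sequentially. norm (lp_form p K (x n)) \<le> lp_norm p (K (x n))"
      using Hoelder(2)[OF TK(2) lp_J_lp(1)[OF x(1)]] x by (simp add: lp_J_lp)
  qed
  from tendsto_add[OF lim this]
  have "(\<lambda>n. pairing (\<lambda>j. T (x n) j + K (x n) j) (lp_J p (x n))) \<longlonglongrightarrow> l"
    using TK x by (simp add: pairing_add_left lp_J_lp)
  moreover have "pairing (\<lambda>j. T (x n) j + K (x n) j) (lp_J p (x n)) \<in>
      num_range p (\<lambda>x j. T x j + K x j)" for n
    using x by (auto simp: num_range_def)
  ultimately show "l \<in> closure (num_range p (\<lambda>x j. T x j + K x j))"
    unfolding closure_sequential by (intro exI conjI allI)
qed

lemma ess_num_range_superset: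
  assumes T: "T \<in> lp_operators p"
  shows "(\<Inter>K\<in>lp_compact_operators p. closure (num_range p (\<lambda>x j. T x j + K x j))) \<subseteq> ess_num_range p T"
proof
  fix l assume l: "l \<in> (\<Inter>K\<in>lp_compact_operators p. closure (num_range p (\<lambda>x j. T x j + K x j)))"
  have "\<exists>z. z \<in> lp p \<and> lp_norm p z = 1 \<and> (\<forall>j<n. z j = 0) \<and>
      norm (lp_form p T z - l) < inverse (real (Suc n))" for n
    using tail_form_near_point[OF T l, of "inverse (real (Suc n))" n] by auto
  then obtain z where z: "\<And>n. z n \<in> lp p" "\<And>n. lp_norm p (z n) = 1" "\<And>n j. j < n \<Longrightarrow> z n j = 0"
      and near: "\<And>n. norm (lp_form p T (z n) - l) < inverse (real (Suc n))"
    by metis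
  have "lp_weakly_null p z"
    by (rule tails_weakly_null) (use z in auto)
  moreover have "(\<lambda>n. lp_form p T (z n) - l) \<longlonglongrightarrow> 0"
    by (rule Lim_null_comparison[OF _ LIMSEQ_inverse_real_of_nat])
      (intro always_eventually allI less_imp_le near)
  then have "(\<lambda>n. lp_form p T (z n)) \<longlonglongrightarrow> l"
    by (simp add: LIM_zero_iff)
  ultimately show "l \<in> ess_num_range p T"
    unfolding ess_num_range_def using z by blast
qed

end

theorem theorem3p11:
  fixes p :: real and T :: "(nat \<Rightarrow> complex) \<Rightarrow> nat \<Rightarrow> complex"
  assumes "1 < p" and "T \<in> lp_operators p"
  shows "ess_num_range p T =
    (\<Inter>K\<in>lp_compact_operators p. closure (num_range p (\<lambda>x j. T x j + K x j)))"
proof -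
  have "1 / p + 1 / (p / (p - 1)) = 1"
    using assms(1) by (simp add: field_simps)
  then interpret conjugate_exponents p "p / (p - 1)"
    by unfold_locales (use assms(1) in auto)
  show ?thesis
    using ess_num_range_subset[OF assms(2)] ess_num_range_superset[OF assms(2)] by blast
qed

end
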